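(* Let $D^{\rm in}_{(1)}(n)\ge D^{\rm in}_{(2)}(n)\ge\cdots\ge D^{\rm in}_{(n)}(n)$ and $D^{\rm out}_{(1)}(n)\ge D^{\rm out}_{(2)}(n)\ge\cdots\ge D^{\rm out}_{(n)}(n)$ be the order statistics of the in-degrees $\{D^{\rm in}_v(n)\}_{v\in[n]}$ and of the out-degrees $\{D^{\rm out}_v(n)\}_{v\in[n]}$, respectively. Define the Hill estimators $$H^{\rm in}_{k,n}:=\frac1k\sum_{i=1}^k\log\frac{D^{\rm in}_{(i)}(n)}{D^{\rm in}_{(k+1)}(n)},\qquad H^{\rm out}_{k,n}:=\frac1k\sum_{i=1}^k\log\frac{D^{\rm out}_{(i)}(n)}{D^{\rm out}_{(k+1)}(n)}.$$ Let $\{k_n\}$ be a sequence of positive integers satisfying $\liminf_{n\to\infty}k_n/(n\log n)^{1/2}>0$ and $k_n/n\to0$ as $n\to\infty$. Then, as $n\to\infty$, $$H^{\rm in}_{k_n,n}\to c_{\rm in}\quad\text{and}\quad H^{\rm out}_{k_n,n}\to c_{\rm out}\qquad\text{in probability.}$$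
   Context: Parameters: $\alpha\in(0,1)$, $\gamma=1-\alpha$, $\delta_{\rm in},\delta_{\rm out}>0$, $c_{\rm in}=\alpha/(1+\delta_{\rm in})$, $c_{\rm out}=\gamma/(1+\delta_{\rm out})$. Preferential attachment model: $G(1)$ has one node, labeled $1$, with a self loop (in-degree and out-degree both $1$). Given $G(n)$ with node set $[n]=\{1,\dots,n\}$ and $n$ directed edges, $G(n+1)$ is obtained by adding node $n+1$ and one directed edge: with probability $\alpha$ the edge goes from $n+1$ to $v\in[n]$, chosen with probability $\frac{D^{\rm in}_v(n)+\delta_{\rm in}}{(1+\delta_{\rm in})n}$; with probability $\gamma$ the edge goes from $v\in[n]$ to $n+1$, with $v$ chosen with probability $\frac{D^{\rm out}_v(n)+\delta_{\rm out}}{(1+\delta_{\rm out})n}$. Here $(D^{\rm in}_v(n),D^{\rm out}_v(n))$ are the in- and out-degree of $v$ in $G(n)$. *)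

theory Defs
  imports "HOL-Probability.Probability" "Graph_Theory.Pair_Digraph"
begin

text \<open>
  In the preferential attachment model every node beyond the first brings exactly one edge,
  which joins it to an older node. Hence no parallel edges ever occur, and a set of ordered
  pairs suffices for the edges.
\<close>

definition initial_graph :: "nat pair_pre_digraph" where
  "initial_graph = \<lparr> pverts = {1}, parcs = {(1, 1)} \<rparr>"

definition attach :: "nat \<Rightarrow> nat \<times> nat \<Rightarrow> nat pair_pre_digraph \<Rightarrow> nat pair_pre_digraph" where
  "attach w e g = \<lparr> pverts = insert w (pverts g), parcs = insert e (parcs g) \<rparr>"

text \<open>
  The random graph \<open>G n\<close> is only meaningful for \<open>n \<ge> 1\<close>. The assumptions \<open>step_in\<close> and
  \<open>step_out\<close> prescribe the law of \<open>G (n + 1)\<close> given \<open>G n\<close>: the graphs \<open>attach (n + 1) e g\<close>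
  named there are pairwise distinct, and their conditional probabilities add up to \<open>1\<close> when
  \<open>\<alpha> + \<gamma> = 1\<close>. Conditioning on the whole past would give nothing more, since the node labels
  make the earlier graphs a function of the current one (\<open>G m\<close> is the subgraph of \<open>G n\<close>
  induced by the nodes \<open>1, \<dots>, m\<close>).
\<close>

locale pref_attachment = prob_space M
  for M :: "'a measure"
  and \<alpha> \<gamma> \<delta>in \<delta>out :: real
  and G :: "nat \<Rightarrow> 'a \<Rightarrow> nat pair_pre_digraph" +
  assumes random_graph: "n \<ge> 1 \<Longrightarrow> random_variable (count_space UNIV) (G n)"
    and start: "AE \<omega> in M. G 1 \<omega> = initial_graph"
    and step_in:
      "n \<ge> 1 \<Longrightarrow> \<P>(\<omega> in M. G n \<omega> = g) > 0 \<Longrightarrow> v \<in> {1..n} \<Longrightarrow>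
       \<P>(\<omega> in M. G (n + 1) \<omega> = attach (n + 1) (n + 1, v) g \<bar> G n \<omega> = g) =
         \<alpha> * ((real (in_degree (with_proj g) v) + \<delta>in) / ((1 + \<delta>in) * real n))"
    and step_out:
      "n \<ge> 1 \<Longrightarrow> \<P>(\<omega> in M. G n \<omega> = g) > 0 \<Longrightarrow> v \<in> {1..n} \<Longrightarrow>
       \<P>(\<omega> in M. G (n + 1) \<omega> = attach (n + 1) (v, n + 1) g \<bar> G n \<omega> = g) =
         \<gamma> * ((real (out_degree (with_proj g) v) + \<delta>out) / ((1 + \<delta>out) * real n))"

text \<open>The \<open>i\<close>-th largest of \<open>d 1, \<dots>, d n\<close>, counted with multiplicity, for \<open>1 \<le> i \<le> n\<close>.\<close>

definition order_stat :: "nat \<Rightarrow> (nat \<Rightarrow> nat) \<Rightarrow> nat \<Rightarrow> nat" where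
  "order_stat n d i = rev (sort (map d [1..<n + 1])) ! (i - 1)"

text \<open>
  The estimator is undefined on paper if \<open>k \<ge> n\<close> or the order statistic of rank \<open>k + 1\<close>
  vanishes; the value is then an artefact of totality.
\<close>

definition hill :: "nat \<Rightarrow> nat \<Rightarrow> (nat \<Rightarrow> nat) \<Rightarrow> real" where
  "hill k n d =
     1 / real k * (\<Sum>i = 1..k. ln (real (order_stat n d i) / real (order_stat n d (k + 1))))"

definition hill_in :: "nat \<Rightarrow> nat \<Rightarrow> nat pair_pre_digraph \<Rightarrow> real" where
  "hill_in k n g = hill k n (in_degree (with_proj g))"

definition hill_out :: "nat \<Rightarrow> nat \<Rightarrow> nat pair_pre_digraph \<Rightarrow> real" where
  "hill_out k n g = hill k n (out_degree (with_proj g))"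

definition tendsto_in_prob :: "'a measure \<Rightarrow> (nat \<Rightarrow> 'a \<Rightarrow> real) \<Rightarrow> real \<Rightarrow> bool" where
  "tendsto_in_prob M X c \<longleftrightarrow>
     (\<forall>\<epsilon>>0. (\<lambda>n. \<P>(\<omega> in M. \<bar>X n \<omega> - c\<bar> > \<epsilon>)) \<longlonglongrightarrow> 0)"

end

theory Submission
  imports Defs "HOL-Real_Asymp.Real_Asymp"
begin

text \<open>
  In-degrees and out-degrees both evolve as one and the same Markov chain on degree functions,
  with \<open>\<alpha>\<close> and \<open>\<gamma>\<close> exchanged. For monotone \<open>f\<close> with values in \<open>[0, 1]\<close> one step of the chain
  maps \<open>\<Sum>v. f (d v)\<close> in conditional mean to a sum of the same kind, and the sum moves by at most
  \<open>2\<close>; hence its variance is at most \<open>4 * n\<close>. In particular the number \<open>N\<^sub>j\<close> of nodes of degree at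
  least \<open>j\<close> has fluctuations \<open>O(sqrt n)\<close>, which is \<open>o(k n)\<close>, around its mean, and the mean is within
  \<open>1\<close> of \<open>n * q j\<close> for the solution \<open>q\<close> of \<open>q (j + 1) = c (j + \<delta>) (q j - q (j + 1))\<close>.

  With \<open>D\<close> the order statistic of rank \<open>k + 1\<close>, summation by parts turns \<open>k\<close> times the Hill
  estimator into the sum of \<open>N\<^sub>j * ln (j / (j - 1))\<close> over \<open>j > D\<close>. It is bracketed by the same
  sums over \<open>j > J\<close> for deterministic \<open>J\<close> with \<open>n * q J \<approx> (1 \<plusminus> 2 t) k\<close>, and these are close to
  \<open>c * n * q J\<close> because the recursion for \<open>q\<close> makes the sum of \<open>q j / (j - 1 + \<delta>)\<close> over
  \<open>j > J\<close> telescope to \<open>c * q J\<close>.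
\<close>

section \<open>The Markov chain of degrees\<close>

text \<open>Invariant of in-degrees and out-degrees alike, since \<open>n\<close> nodes carry
  \<open>n\<close> edges. Degree \<open>0\<close> outside \<open>{1..n}\<close> makes the arrival of
  a node a mere function update.\<close>

definition config :: "nat \<Rightarrow> (nat \<Rightarrow> nat) \<Rightarrow> bool" where
  "config n d \<longleftrightarrow> (\<forall>v. v \<notin> {1..n} \<longrightarrow> d v = 0) \<and> (\<Sum>v=1..n. d v) = n"

definition degree_sum :: "nat \<Rightarrow> (nat \<Rightarrow> real) \<Rightarrow> (nat \<Rightarrow> nat) \<Rightarrow> real" where
  "degree_sum n f d = (\<Sum>v=1..n. f (d v))"

definition count_ge :: "nat \<Rightarrow> nat \<Rightarrow> (nat \<Rightarrow> nat) \<Rightarrow> nat" where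
  "count_ge n j d = card {v \<in> {1..n}. j \<le> d v}"

lemma count_ge_eq_degree_sum:
  "real (count_ge n j d) = degree_sum n (\<lambda>x. of_bool (j \<le> x)) d"
  by (simp add: count_ge_def degree_sum_def of_bool_def sum.If_cases Int_def)

lemma config_le: "config n d \<Longrightarrow> d v \<le> n"
  unfolding config_def
  by (metis member_le_sum finite_atLeastAtMost le0)

lemma config_outside: "config n d \<Longrightarrow> v \<notin> {1..n} \<Longrightarrow> d v = 0"
  by (auto simp: config_def)

lemma sum_fun_upd:
  fixes f :: "nat \<Rightarrow> 'b::ab_group_add" and d :: "nat \<Rightarrow> nat"
  assumes "v \<in> {1..n}"
  shows "(\<Sum>u=1..n. f ((d(v := x)) u)) = (\<Sum>u=1..n. f (d u)) - f (d v) + f x"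
proof -
  have "(\<Sum>u=1..n. f ((d(v := x)) u)) = f x + (\<Sum>u\<in>{1..n} - {v}. f (d u))"
    using assms by (subst sum.remove[of _ v]) (auto intro!: sum.cong)
  moreover have "(\<Sum>u=1..n. f (d u)) = f (d v) + (\<Sum>u\<in>{1..n} - {v}. f (d u))"
    using assms by (subst sum.remove[of _ v]) auto
  ultimately show ?thesis by simp
qed

lemma config_increment:
  assumes "config n d" "v \<in> {1..n}"
  shows "config (Suc n) (d(v := Suc (d v)))"
proof -
  have "int (\<Sum>u=1..n. (d(v := Suc (d v))) u) = int (\<Sum>u=1..n. d u) + 1"
    using sum_fun_upd[OF assms(2), of int d "Suc (d v)"] by (simp add: of_nat_sum)
  hence "(\<Sum>u=1..n. (d(v := Suc (d v))) u) = Suc n"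
    using assms(1) unfolding config_def by (simp del: of_nat_sum fun_upd_apply)
  moreover have "(d(v := Suc (d v))) (Suc n) = 0"
    using assms by (auto simp: config_def)
  ultimately have "(\<Sum>u=1..Suc n. (d(v := Suc (d v))) u) = Suc n"
    by (simp del: fun_upd_apply)
  thus ?thesis
    using assms unfolding config_def by auto
qed

lemma config_new:
  assumes "config n d"
  shows "config (Suc n) (d(Suc n := 1))"
proof -
  have "(\<Sum>u=1..n. (d(Suc n := 1)) u) = (\<Sum>u=1..n. d u)"
    by (intro sum.cong) auto
  thus ?thesis
    using assms by (auto simp: config_def)
qed

lemma degree_sum_increment:
  assumes "config n d" "v \<in> {1..n}"
  shows "degree_sum (Suc n) f (d(v := Suc (d v))) = degree_sum n f d + f 0 + (f (Suc (d v)) - f (d v))"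
  using assms(2) config_outside[OF assms(1), of "Suc n"] sum_fun_upd[OF assms(2), of f d "Suc (d v)"]
  by (auto simp: degree_sum_def)

lemma degree_sum_new:
  shows "degree_sum (Suc n) f (d(Suc n := 1)) = degree_sum n f d + f 1"
proof -
  have "(\<Sum>u=1..n. f ((d(Suc n := 1)) u)) = (\<Sum>u=1..n. f (d u))"
    by (intro sum.cong) auto
  thus ?thesis
    by (simp add: degree_sum_def)
qed

section \<open>The degree chain and its mean operator\<close>

locale degree_chain =
  fixes \<alpha> \<gamma> \<delta> :: real
  assumes \<alpha>_pos: "0 < \<alpha>" and \<gamma>_pos: "0 < \<gamma>" and \<alpha>_\<gamma>: "\<alpha> + \<gamma> = 1" and \<delta>_pos: "0 < \<delta>"
begin

definition c :: real where "c = \<alpha> / (1 + \<delta>)"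

lemma c_pos: "0 < c" and c_less: "c * (1 + \<delta>) < 1" and c_less_1: "c < 1"
proof -
  show "0 < c" using \<alpha>_pos \<delta>_pos by (simp add: c_def)
  show "c * (1 + \<delta>) < 1" using \<delta>_pos \<gamma>_pos \<alpha>_\<gamma> by (simp add: c_def)
  moreover have "c * 1 \<le> c * (1 + \<delta>)"
    using \<open>0 < c\<close> \<delta>_pos by (intro mult_left_mono) auto
  ultimately show "c < 1" by simp
qed

text \<open>The transition operator: an old node gains degree with total probability
  \<open>\<alpha>\<close>, the new node with probability \<open>\<gamma>\<close>. At
  \<open>n = 0\<close> the sum is empty, and the weight \<open>1\<close> yields the degree function
  of the initial self loop.\<close>

definition step :: "nat \<Rightarrow> ((nat \<Rightarrow> nat) \<Rightarrow> real) \<Rightarrow> (nat \<Rightarrow> nat) \<Rightarrow> real" where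
  "step n \<phi> d = (\<Sum>v=1..n. c * (real (d v) + \<delta>) / real n * \<phi> (d(v := Suc (d v))))
     + (if n = 0 then 1 else \<gamma>) * \<phi> (d(Suc n := 1))"

text \<open>
  \<open>expct n \<phi>\<close> is the mean of \<open>\<phi>\<close> over the random degree function of the graph on \<open>n\<close> nodes,
  computed from the transition probabilities; \<open>n = 0\<close> is the empty graph.
\<close>

primrec expct :: "nat \<Rightarrow> ((nat \<Rightarrow> nat) \<Rightarrow> real) \<Rightarrow> real" where
  "expct 0 \<phi> = \<phi> (\<lambda>_. 0)"
| "expct (Suc n) \<phi> = expct n (step n \<phi>)"

lemma sum_weights:
  assumes "config n d" "n > 0"
  shows "(\<Sum>v=1..n. c * (real (d v) + \<delta>) / real n) = \<alpha>"
proof -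
  have "(\<Sum>v=1..n. real (d v)) = real n"
    using assms by (simp add: config_def flip: of_nat_sum)
  hence "(\<Sum>v=1..n. c * (real (d v) + \<delta>) / real n) = c * (real n + real n * \<delta>) / real n"
    by (simp add: sum.distrib flip: sum_divide_distrib sum_distrib_left)
  also have "\<dots> = c * (1 + \<delta>)"
    using assms(2) by (simp add: field_simps)
  also have "\<dots> = \<alpha>"
    using \<delta>_pos by (simp add: c_def)
  finally show ?thesis .
qed

lemma step_const: "config n d \<Longrightarrow> step n (\<lambda>_. a) d = a"
proof (cases "n = 0")
  case False
  assume "config n d"
  hence "step n (\<lambda>_. a) d = \<alpha> * a + \<gamma> * a"
    unfolding step_def sum_distrib_right[symmetric] using False by (subst sum_weights) auto
  also have "\<dots> = a"
    using \<alpha>_\<gamma> by (simp flip: distrib_right)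
  finally show ?thesis .
qed (simp add: step_def)

lemma step_add: "step n (\<lambda>d. \<phi> d + \<psi> d) d = step n \<phi> d + step n \<psi> d"
  by (simp add: step_def algebra_simps sum.distrib add_divide_distrib)

lemma step_cmult: "step n (\<lambda>d. a * \<phi> d) d = a * step n \<phi> d"
  unfolding step_def distrib_left sum_distrib_left
  by (intro arg_cong2[of _ _ _ _ "(+)"] sum.cong) (auto simp: mult_ac)

lemma step_mono:
  assumes "config n d" "\<And>d. config (Suc n) d \<Longrightarrow> \<phi> d \<le> \<psi> d"
  shows "step n \<phi> d \<le> step n \<psi> d"
  unfolding step_def using assms c_pos \<delta>_pos \<gamma>_pos
  by (intro add_mono sum_mono mult_left_mono assms(2) config_increment config_new) auto

lemma expct_mono:
  assumes "\<And>d. config n d \<Longrightarrow> \<phi> d \<le> \<psi> d"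
  shows "expct n \<phi> \<le> expct n \<psi>"
  using assms
proof (induction n arbitrary: \<phi> \<psi>)
  case 0
  show ?case using 0[of "\<lambda>_. 0"] by (simp add: config_def)
next
  case (Suc n)
  thus ?case by (auto intro!: Suc.IH step_mono)
qed

lemma expct_cong:
  assumes "\<And>d. config n d \<Longrightarrow> \<phi> d = \<psi> d"
  shows "expct n \<phi> = expct n \<psi>"
  using assms by (intro antisym expct_mono) auto

lemma expct_const [simp]: "expct n (\<lambda>_. a) = a"
proof (induction n)
  case (Suc n)
  have "expct n (step n (\<lambda>_. a)) = expct n (\<lambda>_. a)"
    by (intro expct_cong step_const)
  thus ?case using Suc by simp
qed simp

lemma expct_add: "expct n (\<lambda>d. \<phi> d + \<psi> d) = expct n \<phi> + expct n \<psi>"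
  by (induction n arbitrary: \<phi> \<psi>) (simp_all add: step_add [abs_def])

lemma expct_cmult: "expct n (\<lambda>d. a * \<phi> d) = a * expct n \<phi>"
  by (induction n arbitrary: \<phi>) (simp_all add: step_cmult [abs_def])

lemma expct_diff: "expct n (\<lambda>d. \<phi> d - \<psi> d) = expct n \<phi> - expct n \<psi>"
  using expct_add[of n \<phi> "\<lambda>d. -1 * \<psi> d"] expct_cmult[of n "-1" \<psi>] by simp

lemma expct_sum: "expct n (\<lambda>d. \<Sum>i\<in>A. \<phi> i d) = (\<Sum>i\<in>A. expct n (\<phi> i))"
  by (induction A rule: infinite_finite_induct) (simp_all add: expct_add)

section \<open>One step on degree sums, and variance bounds\<close>

text \<open>
  One step maps \<open>degree_sum f\<close> to \<open>degree_sum (shift f)\<close> up to an additive constant. The cap at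
  \<open>1\<close> is never attained at degrees \<open>\<le> n\<close>; it makes \<open>shift f x\<close> a convex combination of
  \<open>f x\<close> and \<open>f (x + 1)\<close> for all \<open>x\<close>, so that monotonicity and bounds are inherited.
\<close>

definition shift :: "nat \<Rightarrow> (nat \<Rightarrow> real) \<Rightarrow> nat \<Rightarrow> real" where
  "shift n f x = f x + min 1 (c * (real x + \<delta>) / real n) * (f (Suc x) - f x)"

lemma rate_le_1:
  assumes "n > 0" "x \<le> n"
  shows "c * (real x + \<delta>) / real n \<le> 1"
proof -
  have "1 * \<delta> \<le> real n * \<delta>"
    using assms \<delta>_pos by (intro mult_right_mono) auto
  hence "real x + \<delta> \<le> real n * (1 + \<delta>)"
    using assms by (simp add: distrib_left)
  hence "c * (real x + \<delta>) \<le> c * (1 + \<delta>) * real n"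
    using c_pos by (simp add: mult.commute mult.left_commute)
  also have "\<dots> \<le> real n"
    using c_less mult_right_mono[of "c * (1 + \<delta>)" 1 "real n"] by auto
  finally show ?thesis
    using assms by simp
qed

text \<open>Interlacing of \<open>shift n f\<close> with \<open>f\<close>: it yields both the
  monotonicity of \<open>shift n f\<close> and its bounds \<open>0\<close> and
  \<open>1\<close>.\<close>

lemma shift_bounds:
  assumes "mono f"
  shows "f x \<le> shift n f x" "shift n f x \<le> f (Suc x)"
proof -
  have f: "f x \<le> f (Suc x)"
    using assms by (simp add: monoD)
  have t: "0 \<le> min 1 (c * (real x + \<delta>) / real n)"
    using c_pos \<delta>_pos by simp
  show "f x \<le> shift n f x"
    unfolding shift_def using t f mult_nonneg_nonneg[OF t, of "f (Suc x) - f x"] by linarith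
  show "shift n f x \<le> f (Suc x)"
    unfolding shift_def
    using f mult_right_mono[of "min 1 (c * (real x + \<delta>) / real n)" 1 "f (Suc x) - f x"] by simp
qed

lemma mono_shift: "mono f \<Longrightarrow> mono (shift n f)"
  using shift_bounds by (intro mono_iff_le_Suc[THEN iffD2] allI) (meson order_trans)

text \<open>An increment at an old node comes with a new node of degree \<open>0\<close>, hence the
  term \<open>f 0\<close>; otherwise the new node has degree \<open>1\<close>.\<close>

lemma step_degree_sum:
  assumes "config n d" "n > 0"
  shows "step n (degree_sum (Suc n) f) d = degree_sum n (shift n f) d + (\<alpha> * f 0 + \<gamma> * f 1)"
proof -
  let ?p = "\<lambda>v. c * (real (d v) + \<delta>) / real n"
  have "step n (degree_sum (Suc n) f) d
      = (\<Sum>v=1..n. ?p v * (degree_sum n f d + f 0 + (f (Suc (d v)) - f (d v)))) + \<gamma> * (degree_sum n f d + f 1)"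
    unfolding step_def using assms
    by (simp add: degree_sum_increment degree_sum_new del: One_nat_def fun_upd_apply)
  also have "(\<Sum>v=1..n. ?p v * (degree_sum n f d + f 0 + (f (Suc (d v)) - f (d v))))
      = (\<Sum>v=1..n. ?p v * (degree_sum n f d + f 0)) + (\<Sum>v=1..n. ?p v * (f (Suc (d v)) - f (d v)))"
    by (simp add: distrib_left sum.distrib)
  also have "(\<Sum>v=1..n. ?p v * (degree_sum n f d + f 0)) = \<alpha> * (degree_sum n f d + f 0)"
    unfolding sum_distrib_right[symmetric] by (subst sum_weights[OF assms]) simp
  also have "(\<Sum>v=1..n. ?p v * (f (Suc (d v)) - f (d v))) = degree_sum n (shift n f) d - degree_sum n f d"
    unfolding degree_sum_def sum_subtractf[symmetric]
    by (intro sum.cong) (auto simp: shift_def min_absorb2 rate_le_1[OF assms(2) config_le[OF assms(1)]])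
  finally show ?thesis
    using arg_cong[OF \<alpha>_\<gamma>, of "\<lambda>x. x * degree_sum n f d"] by (simp add: distrib_left distrib_right)
qed

text \<open>The second moment about \<open>m\<close> is the conditional variance plus the squared
  distance from \<open>m\<close> to the conditional mean. The variance is at most the second moment
  about the old value, and jumps are at most \<open>2\<close>.\<close>

lemma step_square_dev:
  assumes "config n d" "n > 0" and f: "mono f" "\<And>x. 0 \<le> f x" "\<And>x. f x \<le> 1"
  shows "step n (\<lambda>d. (degree_sum (Suc n) f d - m)\<^sup>2) d \<le> 4 + (step n (degree_sum (Suc n) f) d - m)\<^sup>2"
proof -
  let ?Y = "degree_sum (Suc n) f" and ?s = "degree_sum n f d"
  \<comment> \<open>Centring at the old value \<open>?s\<close> leaves a remainder that is affine in
    \<open>?Y\<close>, on which \<open>step\<close> acts explicitly.\<close>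
  have eq: "(\<lambda>d. (?Y d - m)\<^sup>2) = (\<lambda>d. (?Y d - ?s)\<^sup>2 + (2 * (?s - m) * ?Y d + (m\<^sup>2 - ?s\<^sup>2)))"
    by (auto simp: power2_eq_square algebra_simps)
  have 1: "step n (\<lambda>d. (?Y d - m)\<^sup>2) d
      = step n (\<lambda>d. (?Y d - ?s)\<^sup>2) d + (2 * (?s - m) * step n ?Y d + (m\<^sup>2 - ?s\<^sup>2))"
    unfolding eq step_add step_cmult step_const[OF assms(1)] by simp
  have sq: "\<bar>y\<bar> \<le> 2 \<Longrightarrow> y\<^sup>2 \<le> 4" for y :: real
    using abs_le_square_iff[of y 2] by simp
  have f': "\<bar>f 0 + (f a - f b)\<bar> \<le> 2" "\<bar>f 1\<bar> \<le> 2" "\<bar>f (Suc 0)\<bar> \<le> 2" for a b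
    using f(2,3)[of 0] f(2,3)[of a] f(2,3)[of b] f(2,3)[of "Suc 0"] by (auto simp: abs_if)
  have "step n (\<lambda>d. (?Y d - ?s)\<^sup>2) d \<le> step n (\<lambda>_. 4) d"
    unfolding step_def using assms(1) c_pos \<delta>_pos \<gamma>_pos
    by (intro add_mono sum_mono mult_left_mono)
      (auto simp: degree_sum_increment degree_sum_new[unfolded One_nat_def] add.assoc f' simp del: fun_upd_apply intro!: sq)
  hence 2: "step n (\<lambda>d. (?Y d - ?s)\<^sup>2) d \<le> 4"
    using step_const[OF assms(1)] by simp
  have "2 * (?s - m) * step n ?Y d + (m\<^sup>2 - ?s\<^sup>2) = (step n ?Y d - m)\<^sup>2 - (step n ?Y d - ?s)\<^sup>2"
    by (simp add: power2_eq_square algebra_simps)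
  thus ?thesis
    using 1 2 by (smt (verit) zero_le_power2)
qed

text \<open>
  Since \<open>shift\<close> preserves the class of monotone \<open>f\<close> with values in \<open>[0, 1]\<close>, every step adds
  at most \<open>4\<close>.
\<close>

lemma variance_degree_sum:
  assumes "mono f" "\<And>x. 0 \<le> f x" "\<And>x. f x \<le> 1"
  shows "expct n (\<lambda>d. (degree_sum n f d - expct n (degree_sum n f))\<^sup>2) \<le> 4 * real n"
  using assms
proof (induction n arbitrary: f)
  case 0
  thus ?case by simp
next
  case (Suc n)
  show ?case
  proof (cases "n = 0")
    case True
    thus ?thesis by (simp add: step_def)
  next
    case False
    hence n: "n > 0" by simp
    let ?m = "expct n (step n (degree_sum (Suc n) f))" and ?b = "\<alpha> * f 0 + \<gamma> * f 1"
    have "?m = expct n (\<lambda>d. degree_sum n (shift n f) d + ?b)"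
      by (intro expct_cong step_degree_sum n)
    hence m: "?m = expct n (degree_sum n (shift n f)) + ?b"
      by (simp only: expct_add expct_const)
    have "expct (Suc n) (\<lambda>d. (degree_sum (Suc n) f d - expct (Suc n) (degree_sum (Suc n) f))\<^sup>2)
        \<le> expct n (\<lambda>d. 4 + (step n (degree_sum (Suc n) f) d - ?m)\<^sup>2)"
      using step_square_dev[OF _ n Suc.prems] by (auto intro!: expct_mono)
    also have "\<dots> = expct n (\<lambda>d. 4 + (degree_sum n (shift n f) d - expct n (degree_sum n (shift n f)))\<^sup>2)"
      by (intro expct_cong) (simp add: step_degree_sum[OF _ n] m)
    also have "\<dots> \<le> 4 + 4 * real n"
      unfolding expct_add expct_const
      using order_trans[OF Suc.prems(2) shift_bounds(1)[OF Suc.prems(1)]]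
        order_trans[OF shift_bounds(2)[OF Suc.prems(1)] Suc.prems(3)] Suc.prems(1)
      by (intro add_left_mono Suc.IH mono_shift) auto
    finally show ?thesis by simp
  qed
qed

text \<open>In place of Cauchy-Schwarz, \<open>2 * s * \<bar>x\<bar> \<le> x^2 + s^2\<close> with
  \<open>s = sqrt n\<close> turns the variance bound \<open>4 * n\<close> into
  \<open>2 * s + s / 2\<close>.\<close>

lemma abs_dev_degree_sum:
  assumes "mono f" "\<And>x. 0 \<le> f x" "\<And>x. f x \<le> 1" "n > 0"
  shows "expct n (\<lambda>d. \<bar>degree_sum n f d - expct n (degree_sum n f)\<bar>) \<le> 5/2 * sqrt (real n)"
proof -
  let ?X = "\<lambda>d. degree_sum n f d - expct n (degree_sum n f)" and ?s = "sqrt (real n)"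
  have s: "?s > 0" "?s * ?s = real n" using assms by auto
  have amgm: "\<bar>x\<bar> \<le> 1 / (2 * ?s) * x\<^sup>2 + ?s / 2" for x :: real
  proof -
    have "0 \<le> (\<bar>x\<bar> - ?s)\<^sup>2" by simp
    hence "2 * ?s * \<bar>x\<bar> \<le> x\<^sup>2 + ?s * ?s"
      by (simp add: power2_diff power2_eq_square algebra_simps)
    thus ?thesis using s by (simp add: field_simps power2_eq_square)
  qed
  have "expct n (\<lambda>d. \<bar>?X d\<bar>) \<le> expct n (\<lambda>d. 1 / (2 * ?s) * (?X d)\<^sup>2 + ?s / 2)"
    by (intro expct_mono amgm)
  also have "\<dots> = 1 / (2 * ?s) * expct n (\<lambda>d. (?X d)\<^sup>2) + ?s / 2"
    by (simp only: expct_add expct_cmult expct_const)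
  also have "\<dots> \<le> 1 / (2 * ?s) * (4 * real n) + ?s / 2"
    using variance_degree_sum[OF assms(1-3)] s by (intro add_right_mono mult_left_mono) auto
  also have "\<dots> = 5/2 * ?s"
    using s by (simp add: field_simps)
  finally show ?thesis .
qed

text \<open>The limiting proportion of nodes of degree at least \<open>j\<close>, with the
  stationarity equation solved for \<open>q (Suc j)\<close>. The source \<open>\<gamma>\<close> at
  \<open>j = 0\<close> is the probability that the new node starts with degree
  \<open>1\<close>.\<close>

primrec q :: "nat \<Rightarrow> real" where
  "q 0 = 1"
| "q (Suc j) = (c * (real j + \<delta>) * q j + (if j = 0 then \<gamma> else 0)) / (1 + c * (real j + \<delta>))"

section \<open>Monotonicity and decay of \<open>q\<close>\<close>

lemma rate_pos: "0 < c * (real j + \<delta>)"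
  using c_pos \<delta>_pos by simp

lemma q_pos: "0 < q j"
proof (induction j)
  case (Suc j)
  thus ?case using rate_pos[of j] \<gamma>_pos by (auto intro!: divide_pos_pos add_pos_nonneg)
qed simp

lemma q_rec: "q (Suc j) + c * (real j + \<delta>) * q (Suc j) = c * (real j + \<delta>) * q j + (if j = 0 then \<gamma> else 0)"
  using rate_pos[of j] by (simp add: divide_simps) (simp add: algebra_simps)

lemma q_diff: "j > 0 \<Longrightarrow> q (Suc j) = c * (real j + \<delta>) * (q j - q (Suc j))"
  using q_rec[of j] by (simp add: algebra_simps)

lemma q_1_le: "q (Suc 0) \<le> 1"
  using rate_pos[of 0] \<alpha>_\<gamma> \<alpha>_pos by simp

text \<open>For \<open>j > 0\<close> the ratio \<open>q (Suc j) / q j\<close> is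
  \<open>r / (1 + r)\<close> with \<open>r = c * (j + \<delta>)\<close>, and
  \<open>c * (1 + \<delta>) < 1\<close> gives \<open>r \<le> j\<close>.\<close>

lemma Suc_mult_q_le: "j > 0 \<Longrightarrow> real (Suc j) * q (Suc j) \<le> real j * q j"
proof -
  assume j: "j > 0"
  have "c * (real j + \<delta>) * real (Suc j) \<le> real j * (1 + c * (real j + \<delta>))"
  proof -
    have "real j + \<delta> \<le> real j * (1 + \<delta>)"
      using j \<delta>_pos mult_right_mono[of 1 "real j" \<delta>] by (simp add: algebra_simps)
    hence "c * (real j + \<delta>) \<le> c * (1 + \<delta>) * real j"
      using c_pos by (simp add: mult.commute mult.left_commute)
    also have "\<dots> \<le> real j"
      using c_less j by simp
    finally show ?thesis
      by (simp add: algebra_simps)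
  qed
  hence "c * (real j + \<delta>) * real (Suc j) * q j \<le> real j * (1 + c * (real j + \<delta>)) * q j"
    using q_pos[of j] by (intro mult_right_mono) auto
  thus ?thesis
    using j rate_pos[of j] by (simp add: divide_simps) (simp add: mult_ac)
qed

declare q.simps(2) [simp del]

lemma mult_q_antimono: "i \<le> j \<Longrightarrow> 0 < i \<Longrightarrow> real j * q j \<le> real i * q i"
proof (induction j rule: dec_induct)
  case (step n)
  thus ?case using Suc_mult_q_le[of n] by linarith
qed simp

lemma mult_q_le_1: "real j * q j \<le> 1"
proof (cases "j = 0")
  case False
  thus ?thesis using mult_q_antimono[of 1 j] q_1_le by simp
qed simp

lemma q_Suc_le: "q (Suc j) \<le> q j"
proof (cases "j = 0")
  case False
  thus ?thesis using q_diff[of j] q_pos[of "Suc j"] rate_pos[of j]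
    by (metis diff_ge_0_iff_ge less_le_not_le linorder_not_le mult_nonneg_nonpos neq0_conv nle_le)
qed (use q_1_le in simp)

lemma q_antimono: "i \<le> j \<Longrightarrow> q j \<le> q i"
  using q_Suc_le by (rule lift_Suc_antimono_le)

text \<open>The indicator of degree at least \<open>Suc j\<close> jumps only at degree
  \<open>j\<close>. So \<open>shift\<close> mixes the indicators for \<open>Suc j\<close> and
  \<open>j\<close> with the single rate of degree \<open>j\<close>, and the means satisfy a closed
  recursion.\<close>

lemma expct_count_ge_Suc:
  assumes "n > 0"
  shows "expct (Suc n) (\<lambda>d. real (count_ge (Suc n) (Suc j) d))
     = expct n (\<lambda>d. real (count_ge n (Suc j) d))
       + min 1 (c * (real j + \<delta>) / real n) * (expct n (\<lambda>d. real (count_ge n j d)) - expct n (\<lambda>d. real (count_ge n (Suc j) d)))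
       + (if j = 0 then \<gamma> else 0)"
proof -
  let ?t = "min 1 (c * (real j + \<delta>) / real n)"
  let ?f = "\<lambda>j x. of_bool (j \<le> (x::nat)) :: real"
  have shift: "shift n (?f (Suc j)) x = ?f (Suc j) x + ?t * (?f j x - ?f (Suc j) x)" for x
    by (cases "x = j") (auto simp: shift_def)
  have ds: "degree_sum n (shift n (?f (Suc j))) d
      = degree_sum n (?f (Suc j)) d + ?t * (degree_sum n (?f j) d - degree_sum n (?f (Suc j)) d)" for d
    unfolding degree_sum_def shift
    by (simp only: sum.distrib sum_subtractf sum_distrib_left[symmetric])
  have "expct (Suc n) (\<lambda>d. real (count_ge (Suc n) (Suc j) d))
     = expct n (\<lambda>d. degree_sum n (shift n (?f (Suc j))) d + (\<alpha> * ?f (Suc j) 0 + \<gamma> * ?f (Suc j) 1))"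
    unfolding count_ge_eq_degree_sum by (simp add: step_degree_sum[OF _ assms] cong: expct_cong)
  thus ?thesis
    unfolding ds count_ge_eq_degree_sum expct_add expct_cmult expct_diff expct_const
    by simp
qed

lemma count_ge_eq_0: "config n d \<Longrightarrow> n < j \<Longrightarrow> count_ge n j d = 0"
  by (simp add: count_ge_def) (metis config_le leD le_trans)

text \<open>
  \<open>n * q j\<close> solves the recursion for the mean number of nodes of degree at least \<open>j\<close> exactly,
  and the recursion is a convex combination, so the initial error never grows.
\<close>

lemma mean_count_ge:
  assumes "n > 0"
  shows "\<bar>expct n (\<lambda>d. real (count_ge n j d)) - real n * q j\<bar> \<le> 1"
  using assms
proof (induction n arbitrary: j rule: nat_induct_non_zero)
  case 1
  have "{v \<in> {Suc 0..Suc 0}. j \<le> ((\<lambda>_. 0)(Suc 0 := Suc 0)) v} = (if j \<le> 1 then {Suc 0} else {})" by auto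
  hence "expct 1 (\<lambda>d. real (count_ge 1 j d)) = of_bool (j \<le> 1)"
    by (simp add: step_def count_ge_def)
  thus ?case using q_pos[of j] q_antimono[of 0 j] by (auto simp: of_bool_def)
next
  case (Suc n)
  show ?case
  proof (cases j)
    case 0
    have "{v \<in> {1..Suc n}. 0 \<le> d v} = {1..Suc n}" for d :: "nat \<Rightarrow> nat" by auto
    hence "count_ge (Suc n) 0 d = Suc n" for d by (simp only: count_ge_def card_atLeastAtMost diff_Suc_1)
    hence "expct (Suc n) (\<lambda>d. real (count_ge (Suc n) 0 d)) = real (Suc n)"
      by (simp only: expct_const)
    thus ?thesis using 0 by simp
  next
    case (Suc i)
    show ?thesis
    proof (cases "i \<le> n")
      case True
      let ?t = "c * (real i + \<delta>) / real n"
      let ?e = "\<lambda>j. expct n (\<lambda>d. real (count_ge n j d)) - real n * q j"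
      have t: "0 \<le> ?t" "?t \<le> 1"
        using rate_le_1[OF Suc.hyps True] rate_pos[of i] by auto
      have nt: "real n * ?t = c * (real i + \<delta>)"
        using Suc.hyps by simp
      have q: "q (Suc i) = real n * ?t * (q i - q (Suc i)) + (if i = 0 then \<gamma> else 0)"
        unfolding nt using q_rec[of i] by (simp add: algebra_simps)
      have convex: "\<bar>(1 - t) * x + t * y\<bar> \<le> (1 - t) * \<bar>x\<bar> + t * \<bar>y\<bar>"
        if "0 \<le> t" "t \<le> 1" for t x y :: real
        using that by (intro order_trans[OF abs_triangle_ineq]) (simp add: abs_mult)
      have alg: "E' + t * (E - E') + g - (1 + N) * b = (1 - t) * (E' - N * b) + t * (E - N * a) + (g + N * t * (a - b) - b)"
        for E E' g N a b t :: real by (simp add: algebra_simps)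
      have "expct (Suc n) (\<lambda>d. real (count_ge (Suc n) j d)) - real (Suc n) * q j
          = (1 - ?t) * ?e (Suc i) + ?t * ?e i
            + ((if i = 0 then \<gamma> else 0) + real n * ?t * (q i - q (Suc i)) - q (Suc i))"
        unfolding Suc expct_count_ge_Suc[OF Suc.hyps] min_absorb2[OF t(2)] of_nat_Suc by (rule alg)
      also have "\<dots> = (1 - ?t) * ?e (Suc i) + ?t * ?e i"
        using q by linarith
      also have "\<bar>\<dots>\<bar> \<le> (1 - ?t) * \<bar>?e (Suc i)\<bar> + ?t * \<bar>?e i\<bar>"
        by (rule convex) (use t in auto)
      also have "\<dots> \<le> (1 - ?t) * 1 + ?t * 1"
        using t Suc.IH by (intro add_mono mult_left_mono) auto
      finally show ?thesis by simp
    next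
      case False
      \<comment> \<open>Now \<open>j\<close> exceeds every possible degree, so the count vanishes,
        and \<open>j * q j \<le> 1\<close> bounds the other term.\<close>
      hence j: "Suc n < j" using Suc by simp
      have "expct (Suc n) (\<lambda>d. real (count_ge (Suc n) j d)) = expct (Suc n) (\<lambda>_. 0)"
        by (intro expct_cong) (simp add: count_ge_eq_0[OF _ j])
      hence "expct (Suc n) (\<lambda>d. real (count_ge (Suc n) j d)) = 0"
        by (simp del: expct.simps)
      moreover have "real (Suc n) * q j \<le> real j * q j" "0 \<le> real (Suc n) * q j"
        using j q_pos[of j] by (auto intro!: mult_right_mono)
      ultimately show ?thesis
        using mult_q_le_1[of j] by linarith
    qed
  qed
qed

lemma abs_dev_count_ge:
  assumes "n > 0"
  shows "expct n (\<lambda>d. \<bar>real (count_ge n j d) - real n * q j\<bar>) \<le> 5/2 * sqrt (real n) + 1"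
proof -
  let ?f = "\<lambda>x. of_bool (j \<le> (x::nat)) :: real" and ?m = "expct n (\<lambda>d. real (count_ge n j d))"
  have "expct n (\<lambda>d. \<bar>real (count_ge n j d) - real n * q j\<bar>)
      \<le> expct n (\<lambda>d. \<bar>real (count_ge n j d) - ?m\<bar> + 1)"
    using mean_count_ge[OF assms, of j] by (intro expct_mono) linarith
  also have "\<dots> = expct n (\<lambda>d. \<bar>degree_sum n ?f d - expct n (degree_sum n ?f)\<bar>) + 1"
    by (simp add: expct_add count_ge_eq_degree_sum)
  also have "\<dots> \<le> 5/2 * sqrt (real n) + 1"
    using assms by (intro add_right_mono abs_dev_degree_sum) (auto simp: mono_def)
  finally show ?thesis .
qed

end

section \<open>Order statistics and logarithmic excesses\<close>

text \<open>Sorting permutes the multiset of degrees, so sums over nodes become sums over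
  ranks.\<close>

lemma degree_sum_order_stat: "degree_sum n f d = (\<Sum>i=1..n. f (order_stat n d i))"
proof -
  let ?ys = "rev (sort (map d [1..<n + 1]))"
  have "degree_sum n f d = sum_list (map f (map d [1..<n + 1]))"
    unfolding degree_sum_def map_map sum_list_distinct_conv_sum_set[OF distinct_upt]
    by (intro sum.cong) auto
  also have "\<dots> = sum_list (map f ?ys)"
    by (metis mset_map mset_rev mset_sort sum_mset_sum_list)
  also have "\<dots> = (\<Sum>i=0..<n. f (?ys ! i))"
    by (simp add: sum_list_sum_nth)
  also have "\<dots> = (\<Sum>i=1..n. f (order_stat n d i))"
    unfolding order_stat_def
    by (rule sum.reindex_bij_witness[of _ "\<lambda>i. i - 1" Suc]) auto
  finally show ?thesis .
qed

lemma order_stat_antimono: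
  assumes "1 \<le> i" "i \<le> j" "j \<le> n"
  shows "order_stat n d j \<le> order_stat n d i"
proof -
  have "sorted (rev (rev (sort (map d [1..<n + 1]))))" by simp
  from sorted_rev_nth_mono[OF this, of "i - 1" "j - 1"] show ?thesis
    unfolding order_stat_def using assms by (simp add: diff_le_mono)
qed

lemma count_ge_order_stat: "count_ge n j d = card {i \<in> {1..n}. j \<le> order_stat n d i}"
proof -
  have "real (count_ge n j d) = real (card {i \<in> {1..n}. j \<le> order_stat n d i})"
    unfolding count_ge_eq_degree_sum degree_sum_order_stat
    by (simp add: of_bool_def sum.If_cases Int_def)
  thus ?thesis by simp
qed

text \<open>The ranks whose order statistic is at least \<open>j\<close> form an initial segment of
  \<open>{1..n}\<close>, of length \<open>count_ge n j d\<close>.\<close>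

lemma le_order_stat_iff:
  assumes "1 \<le> i" "i \<le> n"
  shows "j \<le> order_stat n d i \<longleftrightarrow> i \<le> count_ge n j d"
proof
  assume "j \<le> order_stat n d i"
  hence "{1..i} \<subseteq> {i \<in> {1..n}. j \<le> order_stat n d i}"
    using assms order_stat_antimono[of _ i n d] by (auto intro: order_trans)
  from card_mono[OF _ this] show "i \<le> count_ge n j d"
    by (simp add: count_ge_order_stat)
next
  assume i: "i \<le> count_ge n j d"
  show "j \<le> order_stat n d i"
  proof (rule ccontr)
    assume "\<not> j \<le> order_stat n d i"
    hence "{i \<in> {1..n}. j \<le> order_stat n d i} \<subseteq> {1..<i}"
      using assms order_stat_antimono[of i _ n d] by (auto simp: not_le) (meson leD le_trans not_le_imp_less)
    from card_mono[OF _ this] show False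
      using i assms by (simp add: count_ge_order_stat)
  qed
qed

text \<open>The positive part of \<open>ln (x / i)\<close>; the maximum with \<open>1\<close> also
  gives the value \<open>0\<close> at \<open>x = 0\<close>.\<close>

definition log_excess :: "nat \<Rightarrow> nat \<Rightarrow> real" where
  "log_excess i x = ln (max 1 (real x / real i))"

lemma log_excess_nonneg: "0 \<le> log_excess i x"
  by (simp add: log_excess_def)

lemma log_excess_eq_0: "x \<le> i \<Longrightarrow> log_excess i x = 0"
  by (cases "i = 0") (auto simp: log_excess_def max_def divide_simps)

lemma log_excess_ge: "0 < x \<Longrightarrow> 0 < i \<Longrightarrow> ln (real x / real i) \<le> log_excess i x"
  unfolding log_excess_def by (intro ln_mono) auto

lemma log_excess_antimono: "0 < i \<Longrightarrow> i \<le> j \<Longrightarrow> log_excess j x \<le> log_excess i x"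
  unfolding log_excess_def by (intro ln_mono max.mono divide_left_mono) auto

text \<open>
  If the order statistic of rank \<open>k + 1\<close> lies in \<open>[lo, hi)\<close>, then replacing it by a deterministic
  threshold turns the Hill estimator into a sum over all nodes.
\<close>

lemma hill_bracket:
  assumes k: "0 < k" and lo: "0 < lo" "k < count_ge n lo d" and hi: "count_ge n hi d \<le> k"
  shows "degree_sum n (log_excess hi) d \<le> real k * hill k n d"
    and "real k * hill k n d \<le> degree_sum n (log_excess lo) d"
proof -
  let ?y = "order_stat n d" and ?D = "order_stat n d (k + 1)"
  have "count_ge n lo d \<le> card {1..n}"
    unfolding count_ge_def by (intro card_mono) auto
  hence kn: "k + 1 \<le> n" using lo by simp
  have D: "lo \<le> ?D" "?D < hi"
    using le_order_stat_iff[of "k + 1" n lo d] le_order_stat_iff[of "k + 1" n hi d] kn lo hi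
    by auto
  have y: "?D \<le> ?y i" if "i \<in> {1..k}" for i
    using that kn by (intro order_stat_antimono) auto
  have hill: "real k * hill k n d = (\<Sum>i=1..k. ln (real (?y i) / real ?D))"
    using k by (simp add: hill_def)
  \<comment> \<open>Ranks beyond \<open>k\<close> have order statistic at most
    \<open>?D < hi\<close>: they contribute nothing for \<open>hi\<close>, and something nonnegative
    for \<open>lo\<close>.\<close>
  have split: "degree_sum n f d = (\<Sum>i=1..k. f (?y i)) + (\<Sum>i=k+1..n. f (?y i))" for f
    unfolding degree_sum_order_stat using sum.ub_add_nat[of 1 k "\<lambda>i. f (?y i)" "n - k"] kn by simp
  show "degree_sum n (log_excess hi) d \<le> real k * hill k n d"
  proof -
    have "(\<Sum>i=k+1..n. log_excess hi (?y i)) = 0"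
      using order_stat_antimono[of "k + 1" _ n d] D
      by (intro sum.neutral ballI log_excess_eq_0) (auto intro: le_trans less_imp_le)
    moreover have "(\<Sum>i=1..k. log_excess hi (?y i)) \<le> (\<Sum>i=1..k. ln (real (?y i) / real ?D))"
    proof (intro sum_mono)
      fix i assume "i \<in> {1..k}"
      from y[OF this] D lo have "?D \<le> ?y i" "0 < ?D" "?D \<le> hi" by auto
      hence "max 1 (real (?y i) / real hi) \<le> real (?y i) / real ?D"
        by (auto intro!: divide_left_mono)
      thus "log_excess hi (?y i) \<le> ln (real (?y i) / real ?D)"
        unfolding log_excess_def by (intro ln_mono) auto
    qed
    ultimately show ?thesis unfolding hill split by simp
  qed
  show "real k * hill k n d \<le> degree_sum n (log_excess lo) d"
  proof -
    have "(\<Sum>i=1..k. ln (real (?y i) / real ?D)) \<le> (\<Sum>i=1..k. log_excess lo (?y i))"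
    proof (intro sum_mono)
      fix i assume "i \<in> {1..k}"
      from y[OF this] D lo have "0 < ?y i" "0 < ?D" by auto
      thus "ln (real (?y i) / real ?D) \<le> log_excess lo (?y i)"
        using D lo by (intro order_trans[OF log_excess_ge log_excess_antimono]) auto
    qed
    thus ?thesis unfolding hill split
      using sum_nonneg[of "{k+1..n}" "\<lambda>i. log_excess lo (?y i)"] log_excess_nonneg by simp
  qed
qed

section \<open>Summation by parts with the increments of the logarithm\<close>

definition log_gap :: "nat \<Rightarrow> real" where
  "log_gap j = ln (real (Suc j) / real j)"

lemma log_gap_nonneg: "0 \<le> log_gap j"
  by (cases "j = 0") (auto simp: log_gap_def)

lemma sum_log_gap: "0 < i \<Longrightarrow> i \<le> m \<Longrightarrow> (\<Sum>j=i..<m. log_gap j) = ln (real m / real i)"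
proof -
  assume im: "0 < i" "i \<le> m"
  have "(\<Sum>j=i..<m. log_gap j) = (\<Sum>j=i..<m. ln (real (Suc j)) - ln (real j))"
    using im by (intro sum.cong) (auto simp: log_gap_def ln_div)
  also have "\<dots> = ln (real m) - ln (real i)"
    using im by (subst sum_Suc_diff') auto
  finally show ?thesis using im by (simp add: ln_div)
qed

text \<open>Both sides are \<open>ln y \<le> y - 1\<close>, applied to the quotient and to its
  reciprocal. They make \<open>log_gap j * (j + \<delta>)\<close> equal to \<open>1\<close> up to
  \<open>O(1/j)\<close>.\<close>

lemma log_gap_bounds:
  assumes "0 < j"
  shows "1 / real (Suc j) \<le> log_gap j" "log_gap j \<le> 1 / real j"
proof -
  have "log_gap j = ln (1 + 1 / real j)"
    using assms by (simp add: log_gap_def field_simps)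
  thus "log_gap j \<le> 1 / real j"
    using ln_add_one_self_le_self[of "1 / real j"] by simp
  have "ln (real j / real (Suc j)) \<le> real j / real (Suc j) - 1"
    using assms by (intro ln_le_minus_one) auto
  moreover have "ln (real j / real (Suc j)) = - log_gap j"
    using assms by (simp add: log_gap_def ln_div)
  ultimately show "1 / real (Suc j) \<le> log_gap j"
    by (simp add: field_simps)
qed

lemma log_excess_eq_sum:
  assumes "0 < i" "x \<le> N"
  shows "log_excess i x = (\<Sum>j=i..<N. of_bool (Suc j \<le> x) * log_gap j)"
proof (cases "x \<le> i")
  case True
  thus ?thesis by (simp add: log_excess_eq_0)
next
  case False
  have "(\<Sum>j=i..<N. of_bool (Suc j \<le> x) * log_gap j) = (\<Sum>j=i..<x. log_gap j)"
    using assms False by (intro sum.mono_neutral_cong_right) (auto simp: Suc_le_eq)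
  also have "\<dots> = ln (real x / real i)"
    using False assms by (intro sum_log_gap) auto
  finally show ?thesis
    using False assms by (simp add: log_excess_def max_def)
qed

text \<open>Layer-cake form: layer \<open>j\<close> collects the nodes of degree above
  \<open>j\<close>. Any \<open>N \<ge> n\<close> may serve as upper end, since degrees are at most
  \<open>n\<close>.\<close>

lemma degree_sum_log_excess:
  assumes "config n d" "0 < i" "n \<le> N"
  shows "degree_sum n (log_excess i) d = (\<Sum>j=i..<N. real (count_ge n (Suc j) d) * log_gap j)"
proof -
  have "degree_sum n (log_excess i) d = (\<Sum>v=1..n. \<Sum>j=i..<N. of_bool (Suc j \<le> d v) * log_gap j)"
    unfolding degree_sum_def using assms config_le[OF assms(1)]
    by (intro sum.cong refl log_excess_eq_sum) (auto intro: le_trans)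
  also have "\<dots> = (\<Sum>j=i..<N. real (count_ge n (Suc j) d) * log_gap j)"
    unfolding count_ge_eq_degree_sum degree_sum_def
    by (subst sum.swap) (simp only: sum_distrib_right)
  finally show ?thesis .
qed

section \<open>Asymptotics of the Hill estimator\<close>

lemma eventually_ln_ge: "eventually (\<lambda>n::nat. b \<le> ln (real n)) sequentially"
  by real_asymp

context degree_chain
begin

section \<open>Behaviour of \<open>q\<close> at infinity, and the telescoping sum\<close>

lemma q_le_inverse: "0 < j \<Longrightarrow> q j \<le> 1 / real j"
  using mult_q_le_1[of j] by (simp add: field_simps)

lemma q_tendsto_0: "q \<longlonglongrightarrow> 0"
proof (rule tendsto_sandwich[of "\<lambda>_. 0" q _ "\<lambda>j. 1 / real j"])
  show "eventually (\<lambda>j. q j \<le> 1 / real j) sequentially"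
    using eventually_gt_at_top[of 0] by eventually_elim (rule q_le_inverse)
  show "(\<lambda>j. 1 / real j) \<longlonglongrightarrow> 0" by real_asymp
qed (auto intro!: always_eventually less_imp_le q_pos)

text \<open>Consecutive values of \<open>q\<close> are asymptotically equal, so an integer threshold
  can meet a prescribed level of \<open>q\<close> with vanishing relative error.\<close>

lemma q_ratio_tendsto_1: "(\<lambda>j. q (Suc j) / q j) \<longlonglongrightarrow> 1"
proof -
  have "(\<lambda>j. c * (real j + \<delta>) / (1 + c * (real j + \<delta>))) \<longlonglongrightarrow> 1"
    using c_pos by real_asymp
  moreover have "eventually (\<lambda>j. c * (real j + \<delta>) / (1 + c * (real j + \<delta>)) = q (Suc j) / q j) sequentially"
    using eventually_gt_at_top[of 0]
  proof eventually_elim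
    case (elim j)
    thus ?case using q_pos[of j] by (simp add: q.simps)
  qed
  ultimately show ?thesis by (rule Lim_transform_eventually)
qed

text \<open>A consequence of the decrease of \<open>j * q j\<close>; it makes the tail beyond
  \<open>T * J\<close> small relative to \<open>q J\<close>.\<close>

lemma q_mult_le:
  assumes "0 < J" "0 < T"
  shows "q (T * J) \<le> q J / real T"
proof -
  have "J \<le> T * J" using assms by simp
  from mult_q_antimono[OF this assms(1)] have "real T * q (T * J) * real J \<le> q J * real J"
    by (simp add: mult_ac)
  hence "real T * q (T * J) \<le> q J" using assms by simp
  thus ?thesis using assms by (simp add: field_simps)
qed

text \<open>
  By \<open>q (j + 1) = c (j + \<delta>) (q j - q (j + 1))\<close> and \<open>ln ((j + 1) / j) \<approx> 1 / (j + \<delta>)\<close> the sum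
  nearly telescopes; this is where the limit \<open>c\<close> of the Hill estimator comes from.
\<close>

lemma sum_q_log_gap:
  assumes "0 < i" "i \<le> m"
  shows "\<bar>(\<Sum>j=i..<m. q (Suc j) * log_gap j) - c * (q i - q m)\<bar> \<le> (1 + \<delta>) / real i * (c * (q i - q m))"
proof -
  have tele: "(\<Sum>j=i..<m. c * (q j - q (Suc j))) = c * (q i - q m)"
    using sum_Suc_diff'[OF assms(2), of "\<lambda>j. - q j"] by (simp flip: sum_distrib_left)
  have "\<bar>q (Suc j) * log_gap j - c * (q j - q (Suc j))\<bar> \<le> (1 + \<delta>) / real i * (c * (q j - q (Suc j)))"
    if "j \<in> {i..<m}" for j
  proof -
    have j: "0 < j" "i \<le> j" using that assms by auto
    \<comment> \<open>By \<open>q_diff\<close> the term \<open>q (Suc j) * log_gap j\<close> is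
      \<open>c * (q j - q (Suc j))\<close> times \<open>log_gap j * (j + \<delta>)\<close>, so the
      distance of that factor from \<open>1\<close> is what counts.\<close>
    have "log_gap j * (real j + \<delta>) \<le> 1 / real j * (real j + \<delta>)"
      using log_gap_bounds[OF j(1)] \<delta>_pos by (intro mult_right_mono) auto
    also have "\<dots> = 1 + \<delta> / real j" using j by (simp add: field_simps)
    also have "\<dots> \<le> 1 + (1 + \<delta>) / real j" using j by (intro add_left_mono divide_right_mono) auto
    finally have u: "log_gap j * (real j + \<delta>) - 1 \<le> (1 + \<delta>) / real j" by simp
    have "1 - (1 + \<delta>) / real j \<le> 1 - 1 / real (Suc j)"
      using j \<delta>_pos by (intro diff_left_mono frac_le) auto
    also have "\<dots> \<le> 1 / real (Suc j) * (real j + \<delta>)"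
      using \<delta>_pos by (simp add: field_simps)
    also have "\<dots> \<le> log_gap j * (real j + \<delta>)"
      using log_gap_bounds[OF j(1)] \<delta>_pos by (intro mult_right_mono) auto
    finally have "\<bar>log_gap j * (real j + \<delta>) - 1\<bar> \<le> (1 + \<delta>) / real j"
      using u by (simp add: abs_le_iff)
    also have "\<dots> \<le> (1 + \<delta>) / real i"
      using j assms \<delta>_pos by (intro divide_left_mono) auto
    finally have "c * (q j - q (Suc j)) * \<bar>log_gap j * (real j + \<delta>) - 1\<bar> \<le> c * (q j - q (Suc j)) * ((1 + \<delta>) / real i)"
      using q_Suc_le[of j] c_pos by (intro mult_left_mono) auto
    moreover have "q (Suc j) * log_gap j - c * (q j - q (Suc j)) = c * (q j - q (Suc j)) * (log_gap j * (real j + \<delta>) - 1)"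
      by (subst q_diff[OF j(1)]) (simp add: algebra_simps)
    moreover have "\<bar>c * (q j - q (Suc j))\<bar> = c * (q j - q (Suc j))"
      using q_Suc_le[of j] c_pos by simp
    ultimately show ?thesis
      by (simp only: abs_mult mult.commute)
  qed
  hence "\<bar>\<Sum>j=i..<m. (q (Suc j) * log_gap j - c * (q j - q (Suc j)))\<bar>
      \<le> (\<Sum>j=i..<m. (1 + \<delta>) / real i * (c * (q j - q (Suc j))))"
    by (intro sum_abs[THEN order_trans] sum_mono)
  moreover have "(\<Sum>j=i..<m. (q (Suc j) * log_gap j - c * (q j - q (Suc j))))
      = (\<Sum>j=i..<m. q (Suc j) * log_gap j) - c * (q i - q m)"
    unfolding tele[symmetric] by (rule sum_subtractf)
  moreover have "(\<Sum>j=i..<m. (1 + \<delta>) / real i * (c * (q j - q (Suc j)))) = (1 + \<delta>) / real i * (c * (q i - q m))"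
    unfolding tele[symmetric] by (rule sum_distrib_left[symmetric])
  ultimately show ?thesis by simp
qed

lemma sum_q_log_gap_le:
  assumes "0 < i" "i \<le> m"
  shows "(\<Sum>j=i..<m. q (Suc j) * log_gap j) \<le> (2 + \<delta>) * q i"
proof -
  have "0 \<le> q i - q m" using q_antimono[OF assms(2)] by simp
  have "(\<Sum>j=i..<m. q (Suc j) * log_gap j) \<le> c * (q i - q m) + (1 + \<delta>) / real i * (c * (q i - q m))"
    using sum_q_log_gap[OF assms] by linarith
  also have "\<dots> = (1 + (1 + \<delta>) / real i) * (c * (q i - q m))"
    by (simp add: distrib_right)
  also have "\<dots> \<le> (1 + (1 + \<delta>) / 1) * (1 * q i)"
    using assms \<delta>_pos c_pos c_less_1 q_pos[of m] \<open>0 \<le> q i - q m\<close>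
    by (intro mult_mono add_left_mono divide_left_mono) auto
  finally show ?thesis by simp
qed

text \<open>
  The variance bound alone would cost a factor \<open>ln n\<close> in the sum over \<open>j\<close>. So it is used only
  for \<open>J \<le> j < T * J\<close>, and larger \<open>j\<close> are controlled by the mean.
\<close>

lemma abs_dev_log_excess:
  assumes n: "0 < n" and J: "0 < J" and T: "0 < T"
  shows "expct n (\<lambda>d. \<bar>degree_sum n (log_excess J) d - c * (real n * q J)\<bar>)
    \<le> (5/2 * sqrt (real n) + 1) * ln (real T) + ln (real n)
      + real n * q J * ((3 + \<delta>) / real T + (1 + \<delta>) / real J)"
proof -
  define M where "M = T * J"
  \<comment> \<open>With the maximum, the ranges from \<open>J\<close> to \<open>M\<close> and from
    \<open>M\<close> to \<open>N\<close> always fit together; the second is empty if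
    \<open>M \<ge> n\<close>.\<close>
  define N where "N = max n M"
  have JM: "J \<le> M" "0 < M" and MN: "M \<le> N" "n \<le> N" using J T by (auto simp: M_def N_def)
  let ?X = "\<lambda>j d. real (count_ge n (Suc j) d)"
  let ?A = "\<lambda>d. \<Sum>j=J..<M. \<bar>?X j d - real n * q (Suc j)\<bar> * log_gap j"
  let ?B = "\<lambda>d. \<Sum>j=M..<N. ?X j d * log_gap j"
  let ?C = "real n * \<bar>(\<Sum>j=J..<M. q (Suc j) * log_gap j) - c * q J\<bar>"
  have "\<bar>degree_sum n (log_excess J) d - c * (real n * q J)\<bar> \<le> ?A d + (?B d + ?C)" if d: "config n d" for d
  proof -
    let ?a = "\<Sum>j=J..<M. (?X j d - real n * q (Suc j)) * log_gap j"
    have "degree_sum n (log_excess J) d = (\<Sum>j=J..<M. ?X j d * log_gap j) + ?B d"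
      using degree_sum_log_excess[OF d J MN(2)] JM MN by (simp add: sum.atLeastLessThan_concat)
    also have "(\<Sum>j=J..<M. ?X j d * log_gap j) = ?a + real n * (\<Sum>j=J..<M. q (Suc j) * log_gap j)"
      by (simp add: sum_distrib_left algebra_simps flip: sum.distrib)
    finally have "degree_sum n (log_excess J) d - c * (real n * q J)
        = ?a + (?B d + real n * ((\<Sum>j=J..<M. q (Suc j) * log_gap j) - c * q J))"
      by (simp add: algebra_simps)
    moreover have "\<bar>?a\<bar> \<le> ?A d"
      by (rule order_trans[OF sum_abs]) (simp add: abs_mult log_gap_nonneg)
    moreover have "\<bar>?B d\<bar> = ?B d"
      by (simp add: log_gap_nonneg sum_nonneg)
    moreover have "\<bar>real n * ((\<Sum>j=J..<M. q (Suc j) * log_gap j) - c * q J)\<bar> = ?C"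
      by (simp add: abs_mult)
    ultimately show ?thesis by linarith
  qed
  hence "expct n (\<lambda>d. \<bar>degree_sum n (log_excess J) d - c * (real n * q J)\<bar>) \<le> expct n (\<lambda>d. ?A d + (?B d + ?C))"
    by (rule expct_mono)
  also have "\<dots> = expct n ?A + (expct n ?B + ?C)"
    by (simp only: expct_add expct_const)
  also have "expct n ?A \<le> (5/2 * sqrt (real n) + 1) * ln (real T)"
  proof -
    have "expct n ?A = (\<Sum>j=J..<M. log_gap j * expct n (\<lambda>d. \<bar>?X j d - real n * q (Suc j)\<bar>))"
      by (simp only: expct_sum mult.commute[of _ "log_gap _"] expct_cmult)
    also have "\<dots> \<le> (\<Sum>j=J..<M. log_gap j * (5/2 * sqrt (real n) + 1))"
      using abs_dev_count_ge[OF n] log_gap_nonneg by (intro sum_mono mult_left_mono)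
    \<comment> \<open>The total weight between \<open>J\<close> and \<open>T * J\<close> is
      \<open>ln T\<close>, whatever \<open>J\<close> is.\<close>
    also have "\<dots> = ln (real M / real J) * (5/2 * sqrt (real n) + 1)"
      using sum_log_gap[OF J JM(1)] by (simp only: sum_distrib_right [symmetric])
    also have "real M / real J = real T" using J by (simp add: M_def)
    finally show ?thesis by (simp only: mult.commute)
  qed
  \<comment> \<open>As \<open>?B\<close> is nonnegative, its mean suffices: the error
    \<open>1\<close> in each mean count sums to at most \<open>ln n\<close>, and the rest is a tail
    of \<open>q\<close>.\<close>
  also have "expct n ?B \<le> ln (real n) + real n * q J * ((2 + \<delta>) / real T)"
  proof (cases "M < n")
    case False
    hence "N = M" by (simp add: N_def)
    thus ?thesis using n \<delta>_pos q_pos[of J] by simp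
  next
    case True
    hence N: "N = n" by (simp add: N_def)
    have "expct n ?B = (\<Sum>j=M..<N. log_gap j * expct n (?X j))"
      by (simp only: expct_sum mult.commute[of _ "log_gap _"] expct_cmult)
    also have "\<dots> \<le> (\<Sum>j=M..<N. log_gap j * (real n * q (Suc j) + 1))"
    proof (intro sum_mono mult_left_mono log_gap_nonneg)
      fix j show "expct n (?X j) \<le> real n * q (Suc j) + 1"
        using mean_count_ge[OF n, of "Suc j"] by linarith
    qed
    also have "\<dots> = real n * (\<Sum>j=M..<N. q (Suc j) * log_gap j) + (\<Sum>j=M..<N. log_gap j)"
      by (simp add: sum_distrib_left algebra_simps flip: sum.distrib)
    also have "(\<Sum>j=M..<N. log_gap j) = ln (real n / real M)"
      using sum_log_gap[OF JM(2) MN(1)] N by simp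
    also have "\<dots> \<le> ln (real n)"
      using n JM by (intro ln_mono) (auto simp: divide_simps)
    finally have "expct n ?B \<le> real n * (\<Sum>j=M..<N. q (Suc j) * log_gap j) + ln (real n)"
      by simp
    moreover have "(\<Sum>j=M..<N. q (Suc j) * log_gap j) \<le> (2 + \<delta>) * (q J / real T)"
      using sum_q_log_gap_le[OF JM(2) MN(1)] \<delta>_pos
        mult_left_mono[OF q_mult_le[OF J T], of "2 + \<delta>"] by (simp add: M_def)
    hence "real n * (\<Sum>j=M..<N. q (Suc j) * log_gap j) \<le> real n * ((2 + \<delta>) * (q J / real T))"
      by (intro mult_left_mono) auto
    ultimately show ?thesis by (simp add: mult_ac)
  qed
  also have "?C \<le> real n * q J * (1 / real T + (1 + \<delta>) / real J)"
  proof -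
    have q: "q M \<le> q J" using q_antimono JM by simp
    \<comment> \<open>Telescoping stops at \<open>M\<close>; the missing \<open>c * q M\<close> is
      at most \<open>q J / T\<close>.\<close>
    have "\<bar>(\<Sum>j=J..<M. q (Suc j) * log_gap j) - c * q J\<bar> \<le> (1 + \<delta>) / real J * (c * (q J - q M)) + c * q M"
    proof -
      have "0 \<le> c * q M" using c_pos q_pos[of M] by simp
      thus ?thesis
        using sum_q_log_gap[OF J JM(1)] by (simp add: right_diff_distrib)
    qed
    also have "\<dots> \<le> (1 + \<delta>) / real J * (1 * q J) + 1 * (q J / real T)"
      using c_pos c_less_1 \<delta>_pos q q_pos q_mult_le[OF J T]
      by (intro add_mono mult_mono) (auto simp: M_def less_imp_le)
    finally have "\<bar>(\<Sum>j=J..<M. q (Suc j) * log_gap j) - c * q J\<bar> \<le> q J * (1 / real T + (1 + \<delta>) / real J)"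
      by (simp add: algebra_simps)
    thus ?thesis using mult_left_mono[of _ _ "real n"] by (simp add: mult.assoc)
  qed
  finally show ?thesis
    by (simp add: add_divide_distrib distrib_left add_ac mult_ac)
qed

text \<open>\<open>J n\<close> is the first index at which \<open>q\<close> falls to
  \<open>\<theta> * a n\<close>. By minimality \<open>q (J n - 1)\<close> is still above that level,
  and the ratio of the two values of \<open>q\<close> tends to \<open>1\<close>. It is applied with
  \<open>a n = k n / n\<close>.\<close>

lemma threshold_exists:
  assumes a: "a \<longlonglongrightarrow> 0" "eventually (\<lambda>n. 0 < a n) sequentially" and \<theta>: "0 < \<theta>"
  obtains J :: "nat \<Rightarrow> nat" where "filterlim J at_top sequentially" "(\<lambda>n. q (J n) / a n) \<longlonglongrightarrow> \<theta>"
proof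
  define J where "J n = (LEAST j. q j \<le> \<theta> * a n)" for n
  have a\<theta>: "(\<lambda>n. \<theta> * a n) \<longlonglongrightarrow> 0"
    using tendsto_mult_right_zero[OF a(1)] .
  show lim: "filterlim J at_top sequentially"
    unfolding filterlim_at_top
  proof
    fix Z
    have "eventually (\<lambda>n. \<theta> * a n < q Z) sequentially"
      using order_tendstoD(2)[OF a\<theta> q_pos] .
    thus "eventually (\<lambda>n. Z \<le> J n) sequentially"
      using a(2)
    proof eventually_elim
      case (elim n)
      have "\<exists>j. q j \<le> \<theta> * a n"
        using order_tendstoD(2)[OF q_tendsto_0, of "\<theta> * a n"] elim \<theta>
        by (auto simp: eventually_sequentially intro: less_imp_le)
      hence "q (J n) \<le> \<theta> * a n"
        unfolding J_def by (rule LeastI_ex)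
      with elim have "q (J n) < q Z" by simp
      thus ?case using q_antimono[of "J n" Z] by (meson leD nat_le_linear)
    qed
  qed
  show "(\<lambda>n. q (J n) / a n) \<longlonglongrightarrow> \<theta>"
  proof (rule tendsto_sandwich)
    have "(\<lambda>n. q (Suc (J n - 1)) / q (J n - 1)) \<longlonglongrightarrow> 1"
      by (intro filterlim_compose[OF q_ratio_tendsto_1]
          filterlim_compose[OF filterlim_minus_const_nat_at_top lim])
    thus "(\<lambda>n. \<theta> * (q (Suc (J n - 1)) / q (J n - 1))) \<longlonglongrightarrow> \<theta>"
      using tendsto_mult_left by fastforce
    have J1: "eventually (\<lambda>n. 1 \<le> J n) sequentially"
      using lim by (simp add: filterlim_at_top)
    show "eventually (\<lambda>n. \<theta> * (q (Suc (J n - 1)) / q (J n - 1)) \<le> q (J n) / a n) sequentially"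
      using J1 a(2)
    proof eventually_elim
      case (elim n)
      hence "\<theta> * a n < q (J n - 1)"
        using not_less_Least[of "J n - 1" "\<lambda>j. q j \<le> \<theta> * a n"] by (simp add: J_def)
      hence "q (J n) * (\<theta> * a n) \<le> q (J n) * q (J n - 1)"
        using q_pos by (intro mult_left_mono) (auto simp: less_imp_le)
      thus ?case using elim q_pos[of "J n - 1"] by (simp add: field_simps)
    qed
    show "eventually (\<lambda>n. q (J n) / a n \<le> \<theta>) sequentially"
      using a(2)
    proof eventually_elim
      case (elim n)
      have "\<exists>j. q j \<le> \<theta> * a n"
        using order_tendstoD(2)[OF q_tendsto_0, of "\<theta> * a n"] elim \<theta>
        by (auto simp: eventually_sequentially intro: less_imp_le)
      hence "q (J n) \<le> \<theta> * a n"
        unfolding J_def by (rule LeastI_ex)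
      thus ?case using elim by (simp add: field_simps)
    qed
  qed simp
qed

text \<open>Bundles the errors of the two statistics that \<open>hill_bracket\<close> uses at a
  threshold, on the scale \<open>k\<close>, so that one expectation controls both.\<close>

definition deviation :: "nat \<Rightarrow> nat \<Rightarrow> nat \<Rightarrow> (nat \<Rightarrow> nat) \<Rightarrow> real" where
  "deviation k J n d = \<bar>real (count_ge n J d) - real n * q J\<bar> / real k
     + \<bar>degree_sum n (log_excess J) d - c * (real n * q J)\<bar> / real k"

text \<open>Fluctuations of order \<open>sqrt n * ln T\<close> compete with \<open>k n\<close>,
  which is at least of order \<open>sqrt (n * ln n)\<close>. So \<open>T\<close> has to tend to
  infinity, to remove the tail, with \<open>ln T = o(sqrt (ln n))\<close>.\<close>

lemma expct_deviation_tendsto_0: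
  assumes k: "eventually (\<lambda>n. \<eta> * sqrt (real n * ln (real n)) \<le> real (k n)) sequentially" and \<eta>: "0 < \<eta>"
    and J: "filterlim J at_top sequentially"
    and \<theta>: "(\<lambda>n. real n * q (J n) / real (k n)) \<longlonglongrightarrow> \<theta>"
  shows "(\<lambda>n. expct n (deviation (k n) (J n) n)) \<longlonglongrightarrow> 0"
proof (rule tendsto_sandwich)
  show "eventually (\<lambda>n. 0 \<le> expct n (deviation (k n) (J n) n)) sequentially"
  proof (intro always_eventually allI)
    fix n
    have "expct n (\<lambda>_. 0) \<le> expct n (deviation (k n) (J n) n)"
      by (intro expct_mono) (simp add: deviation_def)
    thus "0 \<le> expct n (deviation (k n) (J n) n)" by simp
  qed
  \<comment> \<open>Any exponent strictly between \<open>0\<close> and \<open>1/2\<close> would do,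
    as the crude \<open>ln T \<le> T - 1\<close> shows. The successor ensures \<open>T n > 0\<close>
    and rounds up.\<close>
  define T where "T n = Suc (nat \<lfloor>ln (real n) powr (1/4)\<rfloor>)" for n :: nat
  let ?b = "\<lambda>n. (5/2 * sqrt (real n) + 1) * (1 + ln (real n) powr (1/4)) + ln (real n)"
  let ?s = "\<lambda>n. \<eta> * sqrt (real n * ln (real n))"
  let ?r = "\<lambda>n. real n * q (J n) / real (k n)"
  let ?u = "\<lambda>n. ?b n / ?s n + ?r n * ((3 + \<delta>) / ln (real n) powr (1/4) + (1 + \<delta>) / real (J n))"
  have "(\<lambda>n. ?b n / ?s n) \<longlonglongrightarrow> 0"
    using \<eta> by real_asymp
  moreover have "(\<lambda>n::nat. (3 + \<delta>) / ln (real n) powr (1/4)) \<longlonglongrightarrow> 0"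
    by real_asymp
  moreover have "(\<lambda>n. (1 + \<delta>) / real (J n)) \<longlonglongrightarrow> 0"
    by (intro tendsto_divide_0[OF tendsto_const] filterlim_at_top_imp_at_infinity
        filterlim_compose[OF filterlim_real_sequentially J])
  ultimately have "?u \<longlonglongrightarrow> 0 + \<theta> * (0 + 0)"
    by (intro tendsto_intros \<theta>)
  hence u0: "?u \<longlonglongrightarrow> 0" by simp
  have J1: "eventually (\<lambda>n. 1 \<le> J n) sequentially"
    using J by (simp add: filterlim_at_top)
  show "eventually (\<lambda>n. expct n (deviation (k n) (J n) n) \<le> ?u n) sequentially"
    using k J1 eventually_gt_at_top[of 0] eventually_ln_ge[of 1]
  proof eventually_elim
    case (elim n)
    have ln_pos: "0 < ln (real n)" using elim(4) by linarith
    have L: "0 < ln (real n) powr (1/4)" by (subst powr_gt_zero) (use ln_pos in linarith)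
    have s: "0 < ?s n" using elim(3) ln_pos \<eta> by (intro mult_pos_pos real_sqrt_gt_zero) auto
    hence kn: "0 < real (k n)" using elim by linarith
    have lnT: "ln (real (T n)) \<le> ln (real n) powr (1/4)"
    proof -
      have "ln (real (T n)) \<le> real (T n) - 1"
        by (intro ln_le_minus_one) (unfold T_def of_nat_0_less_iff, rule zero_less_Suc)
      also have "\<dots> \<le> ln (real n) powr (1/4)" by (simp add: T_def)
      finally show ?thesis .
    qed
    have T: "ln (real n) powr (1/4) \<le> real (T n)"
    proof -
      have "ln (real n) powr (1/4) < real_of_int \<lfloor>ln (real n) powr (1/4)\<rfloor> + 1" by linarith
      also have "\<dots> \<le> real (T n)" by (simp add: T_def)
      finally show ?thesis by simp
    qed
    have "expct n (deviation (k n) (J n) n)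
        = (1 / real (k n)) * (expct n (\<lambda>d. \<bar>real (count_ge n (J n) d) - real n * q (J n)\<bar>)
          + expct n (\<lambda>d. \<bar>degree_sum n (log_excess (J n)) d - c * (real n * q (J n))\<bar>))"
      unfolding deviation_def expct_add distrib_left
      by (simp flip: expct_cmult)
    also have "\<dots> \<le> (1 / real (k n)) * ((5/2 * sqrt (real n) + 1) + ((5/2 * sqrt (real n) + 1) * ln (real (T n)) + ln (real n)
      + real n * q (J n) * ((3 + \<delta>) / real (T n) + (1 + \<delta>) / real (J n))))"
      using elim by (intro mult_left_mono add_mono abs_dev_count_ge abs_dev_log_excess) (auto simp: T_def)
    also have "\<dots> \<le> (1 / real (k n)) * ((5/2 * sqrt (real n) + 1) + ((5/2 * sqrt (real n) + 1) * ln (real n) powr (1/4) + ln (real n)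
      + real n * q (J n) * ((3 + \<delta>) / ln (real n) powr (1/4) + (1 + \<delta>) / real (J n))))"
      using lnT T mult_pos_pos[OF less_le_trans[OF L T] L] \<delta>_pos q_pos[of "J n"]
      by (intro mult_left_mono add_left_mono add_right_mono add_mono divide_left_mono order_refl) auto
    also have "\<dots> = ?b n / real (k n) + ?r n * ((3 + \<delta>) / ln (real n) powr (1/4) + (1 + \<delta>) / real (J n))"
      using kn by (simp add: add_divide_distrib algebra_simps)
    also have "?b n / real (k n) \<le> ?b n / ?s n"
      using elim s kn by (intro divide_left_mono) auto
    finally show ?case by simp
  qed
  show "?u \<longlonglongrightarrow> 0" by (rule u0)
qed simp

text \<open>Markov's inequality for the deviations at two thresholds: when both are below
  \<open>t\<close>, the bracket holds and the estimator is within \<open>4 * t\<close> of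
  \<open>c\<close>.\<close>

theorem hill_converges:
  fixes k :: "nat \<Rightarrow> nat"
  assumes k: "\<And>n. n \<ge> 1 \<Longrightarrow> k n \<ge> 1"
    and k_lower: "liminf (\<lambda>n. ereal (real (k n) / sqrt (real n * ln (real n)))) > 0"
    and k_upper: "(\<lambda>n. real (k n) / real n) \<longlonglongrightarrow> 0"
    and \<epsilon>: "0 < \<epsilon>"
  shows "(\<lambda>n. expct n (\<lambda>d. of_bool (\<bar>hill (k n) n d - c\<bar> > \<epsilon>))) \<longlonglongrightarrow> 0"
proof -
  obtain \<eta> where \<eta>: "0 < \<eta>" "eventually (\<lambda>n. \<eta> * sqrt (real n * ln (real n)) \<le> real (k n)) sequentially"
  proof -
    obtain e where e: "0 < ereal e" "ereal e < liminf (\<lambda>n. ereal (real (k n) / sqrt (real n * ln (real n))))"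
      using ereal_dense2[OF k_lower] by auto
    have "eventually (\<lambda>n. ereal e < ereal (real (k n) / sqrt (real n * ln (real n)))) sequentially"
      using e(2) by (rule less_LiminfD)
    hence "eventually (\<lambda>n. e * sqrt (real n * ln (real n)) \<le> real (k n)) sequentially"
      using eventually_gt_at_top[of 0] eventually_ln_ge[of 1]
    proof eventually_elim
      case (elim n)
      hence "0 < ln (real n)" by linarith
      hence "0 < sqrt (real n * ln (real n))"
        using elim(2) by (intro real_sqrt_gt_zero mult_pos_pos) auto
      thus ?case using elim by (simp add: pos_less_divide_eq less_imp_le)
    qed
    thus ?thesis using e that[of e] by simp
  qed
  have a_pos: "eventually (\<lambda>n. 0 < real (k n) / real n) sequentially"
    using eventually_gt_at_top[of 0]
  proof eventually_elim
    case (elim n)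
    thus ?case using k[of n] by simp
  qed
  \<comment> \<open>The offset \<open>2 * t\<close> of the thresholds absorbs an error
    \<open>t\<close> in the limit of \<open>n * q / k\<close> and a random error \<open>t\<close> in
    the count. As \<open>c < 1\<close>, the estimator is then off by at most
    \<open>3 * t + t \<le> \<epsilon>\<close>; \<open>4 * t \<le> 1\<close> keeps
    \<open>1 - 2 * t\<close> positive.\<close>
  define t where "t = min 1 \<epsilon> / 4"
  have t: "0 < t" "4 * t \<le> 1" "4 * t \<le> \<epsilon>" using \<epsilon> by (auto simp: t_def)
  have conv: "q j / (x / y) = y * q j / x" for j and x y :: real by simp
  obtain lo where lo: "filterlim lo at_top sequentially" "(\<lambda>n. real n * q (lo n) / real (k n)) \<longlonglongrightarrow> 1 + 2 * t"
    using threshold_exists[OF k_upper a_pos, of "1 + 2 * t"] t unfolding conv by auto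
  obtain hi where hi: "filterlim hi at_top sequentially" "(\<lambda>n. real n * q (hi n) / real (k n)) \<longlonglongrightarrow> 1 - 2 * t"
    using threshold_exists[OF k_upper a_pos, of "1 - 2 * t"] t unfolding conv by auto
  let ?R = "\<lambda>n. 1 / t * (expct n (deviation (k n) (lo n) n) + expct n (deviation (k n) (hi n) n))"
  show ?thesis
  proof (rule tendsto_sandwich)
    show "eventually (\<lambda>n. 0 \<le> expct n (\<lambda>d. of_bool (\<bar>hill (k n) n d - c\<bar> > \<epsilon>))) sequentially"
    proof (intro always_eventually allI)
      fix n
      have "expct n (\<lambda>_. 0) \<le> expct n (\<lambda>d. of_bool (\<bar>hill (k n) n d - c\<bar> > \<epsilon>))"
        by (intro expct_mono) simp
      thus "0 \<le> expct n (\<lambda>d. of_bool (\<bar>hill (k n) n d - c\<bar> > \<epsilon>))" by simp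
    qed
    have lo1: "eventually (\<lambda>n. 1 \<le> lo n) sequentially"
      using lo(1) by (simp add: filterlim_at_top)
    have lo2: "eventually (\<lambda>n. \<bar>real n * q (lo n) / real (k n) - (1 + 2 * t)\<bar> < t) sequentially"
      using tendstoD[OF lo(2) t(1)] by (simp add: dist_real_def)
    have hi2: "eventually (\<lambda>n. \<bar>real n * q (hi n) / real (k n) - (1 - 2 * t)\<bar> < t) sequentially"
      using tendstoD[OF hi(2) t(1)] by (simp add: dist_real_def)
    show "eventually (\<lambda>n. expct n (\<lambda>d. of_bool (\<bar>hill (k n) n d - c\<bar> > \<epsilon>)) \<le> ?R n) sequentially"
      using lo1 lo2 hi2 eventually_gt_at_top[of 0]
    proof eventually_elim
      case (elim n)
      have kn: "0 < k n" using k[of n] elim by simp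
      let ?m = "\<lambda>J. real n * q J / real (k n)"
      \<comment> \<open>The pointwise form of Markov's inequality: the right side is at least
        \<open>1\<close> as soon as one deviation reaches \<open>t\<close>.\<close>
      have "of_bool (\<bar>hill (k n) n d - c\<bar> > \<epsilon>) \<le> 1 / t * (deviation (k n) (lo n) n d + deviation (k n) (hi n) n d)" for d
      proof (cases "deviation (k n) (lo n) n d < t \<and> deviation (k n) (hi n) n d < t")
        case False
        hence "t \<le> deviation (k n) (lo n) n d + deviation (k n) (hi n) n d"
          by (smt (verit) deviation_def divide_nonneg_nonneg abs_ge_zero of_nat_0_le_iff)
        thus ?thesis using t by (simp add: field_simps of_bool_def)
      next
        case True
        have dev: "\<bar>real (count_ge n J d) / real (k n) - ?m J\<bar> < t"
          "\<bar>degree_sum n (log_excess J) d / real (k n) - c * ?m J\<bar> < t"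
          if "deviation (k n) J n d < t" for J
        proof -
          have "\<bar>x\<bar> / real (k n) = \<bar>x / real (k n)\<bar>" for x by simp
          hence "deviation (k n) J n d = \<bar>real (count_ge n J d) / real (k n) - ?m J\<bar>
              + \<bar>degree_sum n (log_excess J) d / real (k n) - c * ?m J\<bar>"
            by (simp add: deviation_def diff_divide_distrib del: abs_divide)
          thus "\<bar>real (count_ge n J d) / real (k n) - ?m J\<bar> < t"
            "\<bar>degree_sum n (log_excess J) d / real (k n) - c * ?m J\<bar> < t"
            using that by linarith+
        qed
        have "1 < real (count_ge n (lo n) d) / real (k n)"
          using dev(1)[of "lo n"] True elim(2) by linarith
        hence cl: "k n < count_ge n (lo n) d" using kn by simp
        have "real (count_ge n (hi n) d) / real (k n) < 1"
          using dev(1)[of "hi n"] True elim(3) by linarith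
        hence ch: "count_ge n (hi n) d \<le> k n" using kn by simp
        have cm: "c * ?m (lo n) \<le> c + 3 * t" "c - 3 * t \<le> c * ?m (hi n)"
        proof -
          have ct: "c * (3 * t) \<le> 1 * (3 * t)"
            using c_less_1 t by (intro mult_right_mono) auto
          have "?m (lo n) \<le> 1 + 3 * t" "1 - 3 * t \<le> ?m (hi n)"
            using elim(2,3) unfolding abs_less_iff by linarith+
          note m = this[THEN mult_left_mono, OF less_imp_le[OF c_pos]]
          have "c * ?m (lo n) \<le> c * (1 + 3 * t)"
            by (rule m(1))
          thus "c * ?m (lo n) \<le> c + 3 * t"
            using ct by (simp add: distrib_left)
          have "c * (1 - 3 * t) \<le> c * ?m (hi n)"
            by (rule m(2))
          thus "c - 3 * t \<le> c * ?m (hi n)"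
            using ct by (simp add: right_diff_distrib)
        qed
        have lo0: "0 < lo n" using elim by simp
        note br = hill_bracket[OF kn lo0 cl ch]
        have "hill (k n) n d \<le> degree_sum n (log_excess (lo n)) d / real (k n)"
          "degree_sum n (log_excess (hi n)) d / real (k n) \<le> hill (k n) n d"
          using br kn by (simp_all add: field_simps)
        hence "\<bar>hill (k n) n d - c\<bar> \<le> \<epsilon>"
          using dev(2)[of "lo n"] dev(2)[of "hi n"] True cm t by linarith
        thus ?thesis using t by (simp add: deviation_def)
      qed
      hence "expct n (\<lambda>d. of_bool (\<bar>hill (k n) n d - c\<bar> > \<epsilon>))
          \<le> expct n (\<lambda>d. 1 / t * (deviation (k n) (lo n) n d + deviation (k n) (hi n) n d))"
        by (intro expct_mono)
      thus ?case by (simp only: expct_cmult expct_add)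
    qed
    show "?R \<longlonglongrightarrow> 0"
      using tendsto_mult_right_zero[OF tendsto_add_zero[OF
          expct_deviation_tendsto_0[OF \<eta>(2,1) lo] expct_deviation_tendsto_0[OF \<eta>(2,1) hi]], of "1 / t"] .
  qed simp
qed

end

section \<open>The random graph\<close>

text \<open>Edges form a set, so it is the freshness of \<open>(a, b)\<close> that makes the degrees
  increase.\<close>

lemma with_proj_attach_degrees:
  fixes w :: nat
  assumes "finite (parcs g)" "(a, b) \<notin> parcs g"
  defines "g' \<equiv> attach w (a, b) g"
  shows "in_degree (with_proj g') = (in_degree (with_proj g))(b := Suc (in_degree (with_proj g) b))"
    and "out_degree (with_proj g') = (out_degree (with_proj g))(a := Suc (out_degree (with_proj g) a))"
proof -
  have "{e. e \<in> insert (a, b) (parcs g) \<and> snd e = v} =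
      (if v = b then insert (a, b) {e. e \<in> parcs g \<and> snd e = v} else {e. e \<in> parcs g \<and> snd e = v})" for v
    by auto
  moreover have "{e. e \<in> insert (a, b) (parcs g) \<and> fst e = v} =
      (if v = a then insert (a, b) {e. e \<in> parcs g \<and> fst e = v} else {e. e \<in> parcs g \<and> fst e = v})" for v
    by auto
  ultimately show "in_degree (with_proj g') = (in_degree (with_proj g))(b := Suc (in_degree (with_proj g) b))"
    "out_degree (with_proj g') = (out_degree (with_proj g))(a := Suc (out_degree (with_proj g) a))"
    using assms(1,2)
    by (auto simp: g'_def attach_def in_degree_def out_degree_def in_arcs_def out_arcs_def fun_eq_iff with_proj_def)
qed

definition new_edges :: "nat \<Rightarrow> (nat \<times> nat) set" where
  "new_edges n = Pair (Suc n) ` {1..n} \<union> (\<lambda>v. (v, Suc n)) ` {1..n}"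

text \<open>The possible values of \<open>G n\<close>: a finite support, on which all means become
  finite sums. The model starts at one node, hence the empty set at \<open>0\<close>.\<close>

fun graphs :: "nat \<Rightarrow> nat pair_pre_digraph set" where
  "graphs 0 = {}"
| "graphs (Suc 0) = {initial_graph}"
| "graphs (Suc (Suc n)) = (\<lambda>(g, e). attach (Suc (Suc n)) e g) ` (graphs (Suc n) \<times> new_edges (Suc n))"

lemma finite_new_edges: "finite (new_edges n)"
  by (simp add: new_edges_def)

lemma finite_graphs: "finite (graphs n)"
  by (induction n rule: graphs.induct) (auto simp: finite_new_edges)

lemma graphs_Suc: "n \<ge> 1 \<Longrightarrow> graphs (Suc n) = (\<lambda>(g, e). attach (Suc n) e g) ` (graphs n \<times> new_edges n)"
  by (cases n) auto

lemma graphs_structure: "g \<in> graphs n \<Longrightarrow> pverts g = {1..n} \<and> parcs g \<subseteq> {1..n} \<times> {1..n}"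
proof (induction n arbitrary: g rule: graphs.induct)
  case 2
  thus ?case by (simp add: initial_graph_def)
next
  case (3 n)
  then obtain h e where "h \<in> graphs (Suc n)" "e \<in> new_edges (Suc n)" "g = attach (Suc (Suc n)) e h"
    by auto
  with 3(1)[of h] show ?case
    by (auto simp: attach_def new_edges_def)
qed simp

lemma graphs_finite_parcs: "g \<in> graphs n \<Longrightarrow> finite (parcs g)"
  using graphs_structure by (meson finite_SigmaI finite_atLeastAtMost finite_subset)

lemma new_edges_fresh: "g \<in> graphs n \<Longrightarrow> e \<in> new_edges n \<Longrightarrow> e \<notin> parcs g"
  using graphs_structure[of g n] by (auto simp: new_edges_def)

text \<open>The labels reveal the past: deleting node \<open>Suc n\<close> and keeping the edges
  inside \<open>{1..n}\<close> recovers the old graph, and the one remaining edge is the new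
  one.\<close>

lemma inj_on_attach: "inj_on (\<lambda>(g, e). attach (Suc n) e g) (graphs n \<times> new_edges n)"
proof -
  let ?old = "{1..n} \<times> {1..n}"
  have pverts: "pverts (attach (Suc n) e g) - {Suc n} = pverts g"
    and old: "parcs (attach (Suc n) e g) \<inter> ?old = parcs g"
    and new: "parcs (attach (Suc n) e g) - ?old = {e}"
    if "g \<in> graphs n" "e \<in> new_edges n" for g e
    using graphs_structure[OF that(1)] that(2) by (auto simp: attach_def new_edges_def)
  show ?thesis
  proof (rule inj_onI, clarify)
    fix g e1 e2 h e1' e2'
    assume *: "g \<in> graphs n" "(e1, e2) \<in> new_edges n" "h \<in> graphs n" "(e1', e2') \<in> new_edges n"
      "attach (Suc n) (e1, e2) g = attach (Suc n) (e1', e2') h"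
    have "pverts g = pverts h" "parcs g = parcs h" "{(e1, e2)} = {(e1', e2')}"
      using pverts[OF *(1,2)] pverts[OF *(3,4)] old[OF *(1,2)] old[OF *(3,4)]
        new[OF *(1,2)] new[OF *(3,4)] *(5) by simp_all
    thus "g = h \<and> (e1, e2) = (e1', e2')"
      by (cases g; cases h) simp
  qed
qed

lemma degrees_attach:
  assumes g: "g \<in> graphs n" "v \<in> {1..n}"
    and din: "config n (in_degree (with_proj g))" and dout: "config n (out_degree (with_proj g))"
  defines "dI \<equiv> in_degree (with_proj g)" and "dO \<equiv> out_degree (with_proj g)"
  shows "in_degree (with_proj (attach (Suc n) (Suc n, v) g)) = dI(v := Suc (dI v))"
    and "in_degree (with_proj (attach (Suc n) (v, Suc n) g)) = dI(Suc n := 1)"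
    and "out_degree (with_proj (attach (Suc n) (Suc n, v) g)) = dO(Suc n := 1)"
    and "out_degree (with_proj (attach (Suc n) (v, Suc n) g)) = dO(v := Suc (dO v))"
proof -
  have e: "(Suc n, v) \<notin> parcs g" "(v, Suc n) \<notin> parcs g"
    using new_edges_fresh[OF g(1)] g(2) by (auto simp: new_edges_def)
  have 0: "in_degree (with_proj g) (Suc n) = 0" "out_degree (with_proj g) (Suc n) = 0"
    using config_outside[OF din, of "Suc n"] config_outside[OF dout, of "Suc n"] by auto
  note attach = with_proj_attach_degrees[OF graphs_finite_parcs[OF g(1)]]
  show "in_degree (with_proj (attach (Suc n) (Suc n, v) g)) = dI(v := Suc (dI v))"
    "in_degree (with_proj (attach (Suc n) (v, Suc n) g)) = dI(Suc n := 1)"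
    "out_degree (with_proj (attach (Suc n) (Suc n, v) g)) = dO(Suc n := 1)"
    "out_degree (with_proj (attach (Suc n) (v, Suc n) g)) = dO(v := Suc (dO v))"
    unfolding attach[OF e(1)] attach[OF e(2)] dI_def dO_def 0 by simp_all
qed

lemma degrees_initial:
  "in_degree (with_proj initial_graph) = (\<lambda>_. 0)(1 := 1)"
  "out_degree (with_proj initial_graph) = (\<lambda>_. 0)(1 := 1)"
proof -
  have "{e. e = (Suc 0, Suc 0) \<and> snd e = v} = (if v = 1 then {(1, 1)} else {})"
    "{e. e = (Suc 0, Suc 0) \<and> fst e = v} = (if v = 1 then {(1, 1)} else {})" for v :: nat
    by auto
  thus "in_degree (with_proj initial_graph) = (\<lambda>_. 0)(1 := 1)"
    "out_degree (with_proj initial_graph) = (\<lambda>_. 0)(1 := 1)"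
    by (auto simp: initial_graph_def in_degree_def out_degree_def in_arcs_def out_arcs_def fun_eq_iff with_proj_def)
qed

lemma config_degrees:
  "g \<in> graphs n \<Longrightarrow> config n (in_degree (with_proj g)) \<and> config n (out_degree (with_proj g))"
proof (induction n arbitrary: g rule: graphs.induct)
  case 2
  thus ?case by (auto simp: degrees_initial config_def)
next
  case (3 n)
  then obtain h e where h: "h \<in> graphs (Suc n)" and e: "e \<in> new_edges (Suc n)"
    and g: "g = attach (Suc (Suc n)) e h" by auto
  note h' = 3(1)[OF h, THEN conjunct1] 3(1)[OF h, THEN conjunct2]
  from e obtain v where v: "v \<in> {1..Suc n}" and "e = (Suc (Suc n), v) \<or> e = (v, Suc (Suc n))"
    by (auto simp: new_edges_def)
  thus ?case
    unfolding g using degrees_attach[OF h v h'] config_increment[OF h'(1) v] config_increment[OF h'(2) v]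
      config_new[OF h'(1)] config_new[OF h'(2)] by (auto simp del: fun_upd_apply)
qed simp

text \<open>Adds the parameter ranges, so that in-degrees and out-degrees become the instances
  \<open>ins\<close> and \<open>outs\<close> of the chain, with \<open>\<alpha>\<close> and
  \<open>\<gamma>\<close> exchanged in the second.\<close>

locale proper_pref_attachment = pref_attachment M \<alpha> \<gamma> \<delta>in \<delta>out G
  for M :: "'a measure" and \<alpha> \<gamma> \<delta>in \<delta>out :: real and G :: "nat \<Rightarrow> 'a \<Rightarrow> nat pair_pre_digraph" +
  assumes weights_pos: "0 < \<alpha>" "0 < \<gamma>" "0 < \<delta>in" "0 < \<delta>out" and weights_sum: "\<alpha> + \<gamma> = 1"

sublocale proper_pref_attachment \<subseteq> ins: degree_chain \<alpha> \<gamma> \<delta>in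
  by unfold_locales (use weights_pos weights_sum in auto)

sublocale proper_pref_attachment \<subseteq> outs: degree_chain \<gamma> \<alpha> \<delta>out
  by unfold_locales (use weights_pos weights_sum in auto)

context proper_pref_attachment
begin

section \<open>The law of the random graph on its finite support\<close>

definition law :: "nat \<Rightarrow> nat pair_pre_digraph \<Rightarrow> real" where
  "law n g = \<P>(\<omega> in M. G n \<omega> = g)"

text \<open>The conditional probability of the new edge \<open>e\<close>. On
  \<open>new_edges n\<close> its first component tells the direction, since the other endpoint is at
  most \<open>n\<close>.\<close>

definition weight :: "nat \<Rightarrow> nat pair_pre_digraph \<Rightarrow> nat \<times> nat \<Rightarrow> real" where
  "weight n g e = (if fst e = Suc n
     then ins.c * (real (in_degree (with_proj g) (snd e)) + \<delta>in) / real n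
     else outs.c * (real (out_degree (with_proj g) (fst e)) + \<delta>out) / real n)"

lemma sum_weight:
  "(\<Sum>e\<in>new_edges n. weight n g e * h e)
    = (\<Sum>v=1..n. ins.c * (real (in_degree (with_proj g) v) + \<delta>in) / real n * h (Suc n, v))
    + (\<Sum>v=1..n. outs.c * (real (out_degree (with_proj g) v) + \<delta>out) / real n * h (v, Suc n))"
proof -
  have "(\<Sum>e\<in>new_edges n. weight n g e * h e)
      = (\<Sum>e\<in>Pair (Suc n) ` {1..n}. weight n g e * h e) + (\<Sum>e\<in>(\<lambda>v. (v, Suc n)) ` {1..n}. weight n g e * h e)"
    unfolding new_edges_def by (rule sum.union_disjoint) auto
  also have "(\<Sum>e\<in>Pair (Suc n) ` {1..n}. weight n g e * h e) = (\<Sum>v=1..n. weight n g (Suc n, v) * h (Suc n, v))"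
    by (subst sum.reindex) (auto simp: inj_on_def)
  also have "(\<Sum>e\<in>(\<lambda>v. (v, Suc n)) ` {1..n}. weight n g e * h e) = (\<Sum>v=1..n. weight n g (v, Suc n) * h (v, Suc n))"
    by (subst sum.reindex) (auto simp: inj_on_def)
  also have "(\<Sum>v=1..n. weight n g (v, Suc n) * h (v, Suc n))
      = (\<Sum>v=1..n. outs.c * (real (out_degree (with_proj g) v) + \<delta>out) / real n * h (v, Suc n))"
    by (intro sum.cong) (auto simp: weight_def)
  finally show ?thesis by (simp add: weight_def)
qed

lemma sum_weight_1:
  assumes "g \<in> graphs n" "n \<ge> 1"
  shows "(\<Sum>e\<in>new_edges n. weight n g e) = 1"
  using sum_weight[of n g "\<lambda>_. 1"] config_degrees[OF assms(1)] assms(2) weights_sum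
    ins.sum_weights[of n "in_degree (with_proj g)"] outs.sum_weights[of n "out_degree (with_proj g)"]
  by simp

lemma graph_event: "n \<ge> 1 \<Longrightarrow> {\<omega> \<in> space M. Q (G n \<omega>)} \<in> events"
  using measurable_sets[OF random_graph, of n "Collect Q"] by (simp add: vimage_def Int_def conj_commute)

lemma prob_graph_in:
  assumes "n \<ge> 1" "finite B"
  shows "\<P>(\<omega> in M. G n \<omega> \<in> B) = (\<Sum>g\<in>B. law n g)"
proof -
  have "{\<omega> \<in> space M. G n \<omega> \<in> B} = (\<Union>g\<in>B. {\<omega> \<in> space M. G n \<omega> = g})" by auto
  also have "prob \<dots> = (\<Sum>g\<in>B. law n g)"
    unfolding law_def using assms graph_event[OF assms(1)]
    by (intro finite_measure_finite_Union) (auto simp: disjoint_family_on_def)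
  finally show ?thesis .
qed

text \<open>The left side is the probability of passing from \<open>g\<close> to its extension, an
  event contained in reaching the extension. For \<open>law n g = 0\<close> the transition law is
  unspecified, but the left side is \<open>0\<close>.\<close>

lemma law_attach_ge:
  assumes n: "n \<ge> 1" and e: "e \<in> new_edges n"
  shows "law n g * weight n g e \<le> law (Suc n) (attach (Suc n) e g)"
proof (cases "law n g = 0")
  case True
  thus ?thesis by (simp add: law_def)
next
  case False
  hence pos: "\<P>(\<omega> in M. G n \<omega> = g) > 0"
    by (simp add: law_def zero_less_measure_iff)
  have "\<P>(\<omega> in M. G (n + 1) \<omega> = attach (n + 1) e g \<bar> G n \<omega> = g) = weight n g e"
    using e step_in[OF n pos] step_out[OF n pos]
    by (auto simp: new_edges_def weight_def ins.c_def outs.c_def)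
  hence "law n g * weight n g e = \<P>(\<omega> in M. G (n + 1) \<omega> = attach (n + 1) e g \<and> G n \<omega> = g)"
    using pos by (simp add: cond_prob_def law_def field_simps)
  also have "\<dots> \<le> law (Suc n) (attach (Suc n) e g)"
    unfolding law_def using graph_event[of "Suc n"] by (intro finite_measure_mono) auto
  finally show ?thesis .
qed

text \<open>
  The lower bounds \<open>law_attach_ge\<close> already add up to \<open>1\<close>, so they are equalities and no
  mass is left outside \<open>graphs (Suc n)\<close>.
\<close>

lemma sum_law: "n \<ge> 1 \<Longrightarrow> (\<Sum>g\<in>graphs n. law n g) = 1"
  and law_attach: "n \<ge> 1 \<Longrightarrow> g \<in> graphs n \<Longrightarrow> e \<in> new_edges n \<Longrightarrow>
    law (Suc n) (attach (Suc n) e g) = law n g * weight n g e"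
proof -
  have step: "(\<Sum>g\<in>graphs (Suc n). law (Suc n) g) = 1 \<and>
      (\<forall>g\<in>graphs n. \<forall>e\<in>new_edges n. law (Suc n) (attach (Suc n) e g) = law n g * weight n g e)"
    if n: "n \<ge> 1" and IH: "(\<Sum>g\<in>graphs n. law n g) = 1" for n
  proof -
    let ?S = "graphs n \<times> new_edges n"
    let ?a = "\<lambda>(g, e). law n g * weight n g e" and ?b = "\<lambda>(g, e). law (Suc n) (attach (Suc n) e g)"
    have "sum ?a ?S = (\<Sum>g\<in>graphs n. law n g * (\<Sum>e\<in>new_edges n. weight n g e))"
      by (simp add: sum.cartesian_product[symmetric] sum_distrib_left)
    hence a: "sum ?a ?S = 1"
      using IH n by (simp add: sum_weight_1)
    have b: "sum ?b ?S = (\<Sum>g\<in>graphs (Suc n). law (Suc n) g)"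
      unfolding graphs_Suc[OF n] by (subst sum.reindex[OF inj_on_attach]) (simp add: case_prod_unfold)
    have le: "?a x \<le> ?b x" if "x \<in> ?S" for x
      using law_attach_ge[OF n] that by auto
    have "(\<Sum>g\<in>graphs (Suc n). law (Suc n) g) \<le> 1"
      using prob_graph_in[OF _ finite_graphs, of "Suc n" "Suc n"]
        prob_le_1[of "{\<omega> \<in> space M. G (Suc n) \<omega> \<in> graphs (Suc n)}"] by simp
    hence eq: "sum ?a ?S = sum ?b ?S"
      using a b sum_mono[of ?S ?a ?b] le by fastforce
    hence "?a x = ?b x" if "x \<in> ?S" for x
      using sum_mono_inv[OF eq _ that] le finite_graphs finite_new_edges by (simp add: that)
    thus ?thesis using a b eq by force
  qed
  have law_1: "(\<Sum>g\<in>graphs 1. law 1 g) = 1"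
    using start prob_eq_1[OF graph_event[OF order_refl, of "\<lambda>g. g = initial_graph"]]
    by (simp add: law_def)
  have sum: "(\<Sum>g\<in>graphs n. law n g) = 1" if "n \<ge> 1" for n
    using that
  proof (induction n rule: nat_induct_at_least)
    case base
    show ?case by (rule law_1)
  next
    case (Suc n)
    thus ?case using step by blast
  qed
  thus "n \<ge> 1 \<Longrightarrow> (\<Sum>g\<in>graphs n. law n g) = 1" .
  show "n \<ge> 1 \<Longrightarrow> g \<in> graphs n \<Longrightarrow> e \<in> new_edges n \<Longrightarrow>
    law (Suc n) (attach (Suc n) e g) = law n g * weight n g e"
    using step sum by blast
qed

text \<open>The tower property: each graph in \<open>graphs (Suc n)\<close> arises from exactly one
  pair of an old graph and a new edge.\<close>

lemma sum_law_Suc: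
  assumes n: "n \<ge> 1"
  shows "(\<Sum>g\<in>graphs (Suc n). law (Suc n) g * h g)
    = (\<Sum>g\<in>graphs n. law n g * (\<Sum>e\<in>new_edges n. weight n g e * h (attach (Suc n) e g)))"
proof -
  have "(\<Sum>g\<in>graphs (Suc n). law (Suc n) g * h g)
      = (\<Sum>(g, e)\<in>graphs n \<times> new_edges n. law n g * (weight n g e * h (attach (Suc n) e g)))"
    unfolding graphs_Suc[OF n]
    by (subst sum.reindex[OF inj_on_attach]) (auto intro!: sum.cong simp: law_attach[OF n])
  thus ?thesis
    by (simp add: sum.cartesian_product[symmetric] sum_distrib_left)
qed

lemma law_1_initial: "law (Suc 0) initial_graph = 1"
  using sum_law[of 1] by simp

text \<open>In-degrees form a Markov chain by themselves: all edges into the new node change them in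
  the same way, so their weights, which depend on out-degrees, merge into the constant
  \<open>\<gamma>\<close>.\<close>

lemma expct_in_degree: "n \<ge> 1 \<Longrightarrow> (\<Sum>g\<in>graphs n. law n g * \<phi> (in_degree (with_proj g))) = ins.expct n \<phi>"
proof (induction n arbitrary: \<phi> rule: nat_induct_at_least)
  case base
  show ?case by (simp add: law_1_initial degrees_initial ins.step_def fun_upd_def)
next
  case (Suc n)
  have "(\<Sum>e\<in>new_edges n. weight n g e * \<phi> (in_degree (with_proj (attach (Suc n) e g))))
      = ins.step n \<phi> (in_degree (with_proj g))" if g: "g \<in> graphs n" for g
  proof -
    note cfg = config_degrees[OF g, THEN conjunct1] config_degrees[OF g, THEN conjunct2]
    have "(\<Sum>v=1..n. outs.c * (real (out_degree (with_proj g) v) + \<delta>out) / real n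
          * \<phi> (in_degree (with_proj (attach (Suc n) (v, Suc n) g))))
        = (\<Sum>v=1..n. outs.c * (real (out_degree (with_proj g) v) + \<delta>out) / real n)
          * \<phi> ((in_degree (with_proj g))(Suc n := 1))"
      unfolding sum_distrib_right by (intro sum.cong) (simp_all add: degrees_attach[OF g _ cfg])
    thus ?thesis
      unfolding sum_weight ins.step_def
      using Suc.hyps outs.sum_weights[OF cfg(2)] by (simp add: degrees_attach[OF g _ cfg])
  qed
  thus ?case
    using Suc.IH[of "ins.step n \<phi>"] by (simp add: sum_law_Suc[OF Suc.hyps])
qed

text \<open>The mirror image: edges leaving the new node give it out-degree \<open>1\<close>, with
  total probability \<open>\<alpha>\<close>.\<close>

lemma expct_out_degree: "n \<ge> 1 \<Longrightarrow> (\<Sum>g\<in>graphs n. law n g * \<phi> (out_degree (with_proj g))) = outs.expct n \<phi>"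
proof (induction n arbitrary: \<phi> rule: nat_induct_at_least)
  case base
  show ?case by (simp add: law_1_initial degrees_initial outs.step_def fun_upd_def)
next
  case (Suc n)
  have "(\<Sum>e\<in>new_edges n. weight n g e * \<phi> (out_degree (with_proj (attach (Suc n) e g))))
      = outs.step n \<phi> (out_degree (with_proj g))" if g: "g \<in> graphs n" for g
  proof -
    note cfg = config_degrees[OF g, THEN conjunct1] config_degrees[OF g, THEN conjunct2]
    have "(\<Sum>v=1..n. ins.c * (real (in_degree (with_proj g) v) + \<delta>in) / real n
          * \<phi> (out_degree (with_proj (attach (Suc n) (Suc n, v) g))))
        = (\<Sum>v=1..n. ins.c * (real (in_degree (with_proj g) v) + \<delta>in) / real n)
          * \<phi> ((out_degree (with_proj g))(Suc n := 1))"
      unfolding sum_distrib_right by (intro sum.cong) (simp_all add: degrees_attach[OF g _ cfg])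
    thus ?thesis
      unfolding sum_weight outs.step_def
      using Suc.hyps ins.sum_weights[OF cfg(1)] by (simp add: degrees_attach[OF g _ cfg])
  qed
  thus ?case
    using Suc.IH[of "outs.step n \<phi>"] by (simp add: sum_law_Suc[OF Suc.hyps])
qed

text \<open>Since \<open>sum_law\<close> leaves no mass outside \<open>graphs n\<close>, every event
  about \<open>G n\<close> reduces to a finite sum.\<close>

lemma prob_graph:
  assumes "n \<ge> 1"
  shows "\<P>(\<omega> in M. Q (G n \<omega>)) = (\<Sum>g\<in>graphs n. law n g * of_bool (Q g))"
proof -
  have "AE \<omega> in M. G n \<omega> \<in> graphs n"
    using prob_eq_1[OF graph_event[OF assms, of "\<lambda>g. g \<in> graphs n"]]
    by (simp add: prob_graph_in[OF assms finite_graphs] sum_law[OF assms])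
  hence "\<P>(\<omega> in M. Q (G n \<omega>)) = \<P>(\<omega> in M. G n \<omega> \<in> {g \<in> graphs n. Q g})"
    by (intro finite_measure_eq_AE graph_event[OF assms]) auto
  also have "\<dots> = (\<Sum>g | g \<in> graphs n \<and> Q g. law n g)"
    by (intro prob_graph_in[OF assms]) (simp add: finite_graphs)
  also have "\<dots> = (\<Sum>g\<in>graphs n. law n g * of_bool (Q g))"
    by (intro sum.mono_neutral_cong_left) (auto simp: finite_graphs)
  finally show ?thesis .
qed

section \<open>Transfer of the limits to the random graph\<close>

lemma hill_in_prob:
  assumes "n \<ge> 1"
  shows "\<P>(\<omega> in M. \<bar>hill_in k n (G n \<omega>) - x\<bar> > \<epsilon>) = ins.expct n (\<lambda>d. of_bool (\<bar>hill k n d - x\<bar> > \<epsilon>))"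
  using prob_graph[OF assms, of "\<lambda>g. \<bar>hill_in k n g - x\<bar> > \<epsilon>"]
    expct_in_degree[OF assms, of "\<lambda>d. of_bool (\<bar>hill k n d - x\<bar> > \<epsilon>)"]
  by (simp add: hill_in_def)

lemma hill_out_prob:
  assumes "n \<ge> 1"
  shows "\<P>(\<omega> in M. \<bar>hill_out k n (G n \<omega>) - x\<bar> > \<epsilon>) = outs.expct n (\<lambda>d. of_bool (\<bar>hill k n d - x\<bar> > \<epsilon>))"
  using prob_graph[OF assms, of "\<lambda>g. \<bar>hill_out k n g - x\<bar> > \<epsilon>"]
    expct_out_degree[OF assms, of "\<lambda>d. of_bool (\<bar>hill k n d - x\<bar> > \<epsilon>)"]
  by (simp add: hill_out_def)

end

theorem theorem6p2:
  fixes M :: "'a measure"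
    and \<alpha> \<gamma> \<delta>in \<delta>out cin cout :: real
    and G :: "nat \<Rightarrow> 'a \<Rightarrow> nat pair_pre_digraph"
    and k :: "nat \<Rightarrow> nat"
  assumes "0 < \<alpha>" and "\<alpha> < 1" and "\<gamma> = 1 - \<alpha>"
    and "\<delta>in > 0" and "\<delta>out > 0"
    and "cin = \<alpha> / (1 + \<delta>in)" and "cout = \<gamma> / (1 + \<delta>out)"
    and "pref_attachment M \<alpha> \<gamma> \<delta>in \<delta>out G"
    and "\<And>n. n \<ge> 1 \<Longrightarrow> k n \<ge> 1"
    and "liminf (\<lambda>n. ereal (real (k n) / sqrt (real n * ln (real n)))) > 0"
    and "(\<lambda>n. real (k n) / real n) \<longlonglongrightarrow> 0"
  shows "tendsto_in_prob M (\<lambda>n \<omega>. hill_in (k n) n (G n \<omega>)) cin \<and>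
         tendsto_in_prob M (\<lambda>n \<omega>. hill_out (k n) n (G n \<omega>)) cout"
proof -
  interpret pref_attachment M \<alpha> \<gamma> \<delta>in \<delta>out G by fact
  interpret proper_pref_attachment M \<alpha> \<gamma> \<delta>in \<delta>out G
    by unfold_locales (use assms(1-5) in auto)
  \<comment> \<open>The identification of the probabilities with chain means is available for
    \<open>n \<ge> 1\<close>, which is enough for a limit.\<close>
  have n1: "eventually (\<lambda>n::nat. n \<ge> 1) sequentially" by (rule eventually_ge_at_top)
  show ?thesis
    unfolding tendsto_in_prob_def
  proof (intro conjI allI impI)
    fix \<epsilon> :: real assume \<epsilon>: "0 < \<epsilon>"
    have cin: "cin = ins.c" and cout: "cout = outs.c"
      using assms(6,7) by (simp_all add: ins.c_def outs.c_def)
    have lim_in: "(\<lambda>n. ins.expct n (\<lambda>d. of_bool (\<bar>hill (k n) n d - ins.c\<bar> > \<epsilon>))) \<longlonglongrightarrow> 0"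
      by (rule ins.hill_converges) (use assms(9-11) \<epsilon> in auto)
    have lim_out: "(\<lambda>n. outs.expct n (\<lambda>d. of_bool (\<bar>hill (k n) n d - outs.c\<bar> > \<epsilon>))) \<longlonglongrightarrow> 0"
      by (rule outs.hill_converges) (use assms(9-11) \<epsilon> in auto)
    show "(\<lambda>n. \<P>(\<omega> in M. \<epsilon> < \<bar>hill_in (k n) n (G n \<omega>) - cin\<bar>)) \<longlonglongrightarrow> 0"
      unfolding cin using lim_in
      by (rule Lim_transform_eventually) (rule eventually_mono[OF n1], simp add: hill_in_prob)
    show "(\<lambda>n. \<P>(\<omega> in M. \<epsilon> < \<bar>hill_out (k n) n (G n \<omega>) - cout\<bar>)) \<longlonglongrightarrow> 0"
      unfolding cout using lim_out
      by (rule Lim_transform_eventually) (rule eventually_mono[OF n1], simp add: hill_out_prob)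
  qed
qed

end
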